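(* Suppose that $\mu$ is doubling with exponent $d$ and $(C_d,d)$-homogeneous, that $\eta$ is $(\alpha_H,A)$-Hölder continuous with $0<\alpha_H\le1$, $A>0$, that $\sup_x|\eta(x)|<\infty$ and $\sup_x\mathrm{Var}(Y|X=x)<\infty$, and that $\mathrm{supp}(\mu)$ is bounded. Then there exists a fixed constant $c\in(0,1)$ such that for $L=\lceil(1-c)M\rceil$, if $kM=\Theta(N^{\frac{2\alpha_H}{2\alpha_H+d}})$ (with $k$ and $M$ allowed to vary with $N$), then, as $N\to\infty$, $$\mathbb E_{\mathcal P}\|\eta_{k,M,L}-\eta\|_2=O\bigl(N^{-\frac{\alpha_H}{2\alpha_H+d}}\bigr),$$ where $\eta_{k,M,L}$ is the $L$-selective $M$-split $k$-NN regression rule.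
   Context: Setting. $(\mathcal X,\rho)$ is a separable metric space, $\mathcal Y\subseteq\mathbb R$, $(X,Y)\sim\mathsf P$ on $\mathcal X\times\mathcal Y$, $\mu$ is the marginal of $X$, $\eta(x)=\mathbb E[Y|X=x]$. $B^o(x,r)$ is the open ball; $\mathrm{supp}(\mu)=\{x:\mu(B^o(x,r))>0\ \forall r>0\}$; $\|h\|_2=(\int|h|^2d\mu)^{1/2}$. Assumptions. Doubling with exponent $d$: $\mu(B^o(x,r))\le2^d\mu(B^o(x,r/2))$ for $x\in\mathrm{supp}(\mu)$, $r>0$. $(C_d,d)$-homogeneous ($C_d>0$): $\mu(B^o(x,r))\ge\min\{C_dr^d,1\}$ for $x\in\mathrm{supp}(\mu)$, $r>0$. Hölder: $|\eta(x)-\eta(x')|\le A\rho(x,x')^{\alpha_H}$ for all $x,x'\in\mathcal X$. Rule. $N$ i.i.d. samples from $\mathsf P$ are split at random into $M$ disjoint subsets $\mathcal D_m=(\mathbf X_m,\mathbf Y_m)$, $m=1,\dots,M$, of equal size $n=N/M$ ($M$ divides $N$, $n\ge k+1$); $\mathcal P=\{\mathcal D_1,\dots,\mathcal D_M\}$. $r_{k}(x;\mathbf X)$ is the distance from $x$ to its $k$-th nearest neighbor in $\mathbf X$; $\eta_k(x;\mathcal D)$ is the average of the labels of the $k$ nearest neighbors of $x$ in $\mathcal D$ (ties broken arbitrarily). For $1\le L\le M$, let $m_1,\dots,m_L$ be the indices of the $L$ smallest values among $(r_{k+1}(x;\mathbf X_m))_{m=1}^M$; then $\eta_{k,M,L}(x)=\frac1L\sum_{j=1}^L\eta_k(x;\mathcal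 D_{m_j})$.
   Formalization: Ties (among neighbors and among selected subsets) are broken by any measurable rule depending on the split, the covariates and the query point but not on the labels; with label-dependent tie-breaking the claim fails, e.g. when μ is a point mass and Y is ±1. *)

theory Defs
  imports "HOL-Probability.Probability" "HOL-Library.Landau_Symbols"
begin

definition marginal :: "('a::metric_space \<times> real) measure \<Rightarrow> 'a measure" where
  "marginal P = distr P borel fst"

definition support :: "'a::metric_space measure \<Rightarrow> 'a set" where
  "support \<mu> = {x. \<forall>r>0. measure \<mu> (ball x r) > 0}"

definition doubling :: "'a::metric_space measure \<Rightarrow> real \<Rightarrow> bool" where
  "doubling \<mu> d \<longleftrightarrow>
     (\<forall>x\<in>support \<mu>. \<forall>r>0. measure \<mu> (ball x r) \<le> 2 powr d * measure \<mu> (ball x (r / 2)))"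

definition homogeneous :: "'a::metric_space measure \<Rightarrow> real \<Rightarrow> real \<Rightarrow> bool" where
  "homogeneous \<mu> C d \<longleftrightarrow>
     (\<forall>x\<in>support \<mu>. \<forall>r>0. measure \<mu> (ball x r) \<ge> min (C * r powr d) 1)"

definition hoelder_continuous :: "real \<Rightarrow> real \<Rightarrow> ('a::metric_space \<Rightarrow> real) \<Rightarrow> bool" where
  "hoelder_continuous \<alpha> A f \<longleftrightarrow> (\<forall>x x'. \<bar>f x - f x'\<bar> \<le> A * dist x x' powr \<alpha>)"

definition covariate_algebra ::
    "('a::metric_space \<times> real) measure \<Rightarrow> ('a \<times> real) measure" where
  "covariate_algebra P = vimage_algebra (space P) fst borel"

text \<open>\<open>regression_function P \<eta>\<close>: \<open>\<eta>\<close> is a version of \<open>x \<mapsto> E[Y | X = x]\<close>.\<close>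

definition regression_function ::
    "('a::metric_space \<times> real) measure \<Rightarrow> ('a \<Rightarrow> real) \<Rightarrow> bool" where
  "regression_function P \<eta> \<longleftrightarrow>
     integrable P snd \<and> \<eta> \<in> borel_measurable borel \<and>
     (AE z in P. real_cond_exp P (covariate_algebra P) snd z = \<eta> (fst z))"

text \<open>
  \<open>conditional_variance P \<eta> v\<close>: \<open>v\<close> is a (finite) version of \<open>x \<mapsto> Var(Y | X = x)\<close>, where \<open>\<eta>\<close> is a
  version of the regression function.  The conditional expectation is taken in
  \<^typ>\<open>ennreal\<close>, so that square integrability of \<open>Y\<close> is not presupposed.
\<close>

definition conditional_variance ::
    "('a::metric_space \<times> real) measure \<Rightarrow> ('a \<Rightarrow> real) \<Rightarrow> ('a \<Rightarrow> real) \<Rightarrow> bool" where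
  "conditional_variance P \<eta> v \<longleftrightarrow>
     v \<in> borel_measurable borel \<and> (\<forall>x. 0 \<le> v x) \<and>
     (AE z in P. nn_cond_exp P (covariate_algebra P)
                   (\<lambda>z. ennreal ((snd z - \<eta> (fst z))\<^sup>2)) z = ennreal (v (fst z)))"

definition L2_norm :: "'a measure \<Rightarrow> ('a \<Rightarrow> real) \<Rightarrow> real" where
  "L2_norm \<mu> h = sqrt (\<integral>x. \<bar>h x\<bar>\<^sup>2 \<partial>\<mu>)"

text \<open>
  The samples are indexed by \<open>{..<N}\<close>.  A split into \<open>M\<close> disjoint subsets of equal size is given by
  the function \<open>s\<close> which maps each sample index to the number of the subset containing it.
\<close>

definition equal_splits :: "nat \<Rightarrow> nat \<Rightarrow> (nat \<Rightarrow> nat) set" where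
  "equal_splits N M =
     {s \<in> {..<N} \<rightarrow>\<^sub>E {..<M}. \<forall>m<M. card {i \<in> {..<N}. s i = m} = N div M}"

definition block :: "nat \<Rightarrow> (nat \<Rightarrow> nat) \<Rightarrow> nat \<Rightarrow> nat set" where
  "block N s m = {i \<in> {..<N}. s i = m}"

definition split_sample ::
    "('a \<times> real) measure \<Rightarrow> nat \<Rightarrow> nat \<Rightarrow> ((nat \<Rightarrow> nat) \<times> (nat \<Rightarrow> 'a \<times> real)) measure" where
  "split_sample P N M =
     uniform_count_measure (equal_splits N M) \<Otimes>\<^sub>M (\<Pi>\<^sub>M i\<in>{..<N}. P)"

definition admissible_split :: "nat \<Rightarrow> nat \<Rightarrow> nat \<Rightarrow> bool" where
  "admissible_split N k M \<longleftrightarrow> 1 \<le> k \<and> 1 \<le> M \<and> M dvd N \<and> k + 1 \<le> N div M"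

text \<open>\<open>J\<close> consists of \<open>k\<close> indices from \<open>I\<close> with the smallest values of \<open>f\<close>, ties broken arbitrarily.\<close>

definition k_smallest :: "nat \<Rightarrow> nat set \<Rightarrow> (nat \<Rightarrow> real) \<Rightarrow> nat set \<Rightarrow> bool" where
  "k_smallest k I f J \<longleftrightarrow> J \<subseteq> I \<and> card J = k \<and> (\<forall>i\<in>J. \<forall>j\<in>I - J. f i \<le> f j)"

definition nn_distance :: "nat \<Rightarrow> nat set \<Rightarrow> (nat \<Rightarrow> 'a::metric_space) \<Rightarrow> 'a \<Rightarrow> real" where
  "nn_distance k I X x = sort (map (\<lambda>i. dist x (X i)) (sorted_list_of_set I)) ! (k - 1)"

text \<open>
  A way of breaking ties, both among the sample points and among the subsets: given the split \<open>s\<close>,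
  all covariates \<open>X\<close> and the query point \<open>x\<close>, \<open>nb s X x m\<close> is the set of the indices of the \<open>k\<close>
  nearest neighbors of \<open>x\<close> in the \<open>m\<close>-th subset, and \<open>sel s X x\<close> is the set of the \<open>L\<close> selected
  subsets.  Both are arbitrary measurable choices, but they cannot depend on the labels
  (otherwise ties at an atom of the marginal could be used to bias the estimate).
  Measurability makes the regression estimate jointly measurable in the split, the sample and the
  query point.
\<close>

definition selection_rule ::
    "nat \<Rightarrow> nat \<Rightarrow> nat \<Rightarrow> nat
     \<Rightarrow> ((nat \<Rightarrow> nat) \<Rightarrow> (nat \<Rightarrow> 'a::metric_space) \<Rightarrow> 'a \<Rightarrow> nat \<Rightarrow> nat set)
     \<Rightarrow> ((nat \<Rightarrow> nat) \<Rightarrow> (nat \<Rightarrow> 'a) \<Rightarrow> 'a \<Rightarrow> nat set) \<Rightarrow> bool" where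
  "selection_rule N k M L nb sel \<longleftrightarrow>
     (\<forall>s\<in>equal_splits N M.
        (\<forall>X\<in>{..<N} \<rightarrow>\<^sub>E UNIV. \<forall>x.
           (\<forall>m<M. k_smallest k (block N s m) (\<lambda>i. dist x (X i)) (nb s X x m)) \<and>
           k_smallest L {..<M} (\<lambda>m. nn_distance (k + 1) (block N s m) X x) (sel s X x)) \<and>
        (\<forall>m<M. \<forall>i<N. {p \<in> ({..<N} \<rightarrow>\<^sub>E UNIV) \<times> UNIV. i \<in> nb s (fst p) (snd p) m}
           \<in> sets ((\<Pi>\<^sub>M i\<in>{..<N}. borel) \<Otimes>\<^sub>M borel)) \<and>
        (\<forall>m<M. {p \<in> ({..<N} \<rightarrow>\<^sub>E UNIV) \<times> UNIV. m \<in> sel s (fst p) (snd p)}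
           \<in> sets ((\<Pi>\<^sub>M i\<in>{..<N}. borel) \<Otimes>\<^sub>M borel)))"

definition selective_knn ::
    "nat \<Rightarrow> nat \<Rightarrow> nat
     \<Rightarrow> ((nat \<Rightarrow> nat) \<Rightarrow> (nat \<Rightarrow> 'a) \<Rightarrow> 'a \<Rightarrow> nat \<Rightarrow> nat set)
     \<Rightarrow> ((nat \<Rightarrow> nat) \<Rightarrow> (nat \<Rightarrow> 'a) \<Rightarrow> 'a \<Rightarrow> nat set)
     \<Rightarrow> (nat \<Rightarrow> nat) \<times> (nat \<Rightarrow> 'a \<times> real) \<Rightarrow> 'a \<Rightarrow> real" where
  "selective_knn N k L nb sel \<omega> x =
     (let s = fst \<omega>; D = snd \<omega>; X = (\<lambda>i\<in>{..<N}. fst (D i)) in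
      (\<Sum>m\<in>sel s X x. (\<Sum>i\<in>nb s X x m. snd (D i)) / real k) / real L)"

definition selective_knn_risk ::
    "('a::metric_space \<times> real) measure \<Rightarrow> ('a \<Rightarrow> real) \<Rightarrow> nat \<Rightarrow> nat \<Rightarrow> nat \<Rightarrow> nat
     \<Rightarrow> ((nat \<Rightarrow> nat) \<Rightarrow> (nat \<Rightarrow> 'a) \<Rightarrow> 'a \<Rightarrow> nat \<Rightarrow> nat set)
     \<Rightarrow> ((nat \<Rightarrow> nat) \<Rightarrow> (nat \<Rightarrow> 'a) \<Rightarrow> 'a \<Rightarrow> nat set) \<Rightarrow> real" where
  "selective_knn_risk P \<eta> N k M L nb sel =
     (\<integral>\<omega>. L2_norm (marginal P) (\<lambda>x. selective_knn N k L nb sel \<omega> x - \<eta> x) \<partial>split_sample P N M)"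

end

theory Submission
  imports Defs "HOL-Real_Asymp.Real_Asymp"
begin

text \<open>
  The selection of the subsets plays no role beyond keeping at least half of them.  The rule averages
  \<open>k * L\<close> labels over an index set that depends on the covariates only, so the centred labels are
  orthogonal and contribute at most \<open>V / (k * L)\<close> to the mean square error.  By Hoelder continuity and
  Jensen's inequality, the squared bias is at most \<open>A\<^sup>2\<close> times the mean of \<open>\<rho>(x, X\<^sub>i)\<close> to the power \<open>2 * \<alpha>\<close>
  over the selected indices; bounding the sum over the selected subsets by the sum over all \<open>M\<close>
  subsets only costs the factor \<open>M / L \<le> 2\<close>.  In a single subset of size \<open>n\<close>, homogeneity and a Chernoff
  bound give the radius containing \<open>k\<close> points an exponential tail on the scale
  \<open>(k / (n * C))\<close> to the power \<open>1 / d\<close>, hence all its moments.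
\<close>

section \<open>Orthogonality of the noise\<close>

text \<open>The conditional moments of the noise appear in tested form, since sample coordinates
  will be integrated out one at a time against weights that depend on the covariate. The variance
  test is stated in \<open>ennreal\<close>, so square integrability of the noise is a consequence
  (test function 1). Hence the zero in \<open>noise_mean\<close> is a genuine integral and not the
  default value for a non-integrable function.\<close>

locale regression_model = prob_space P
  for P :: "('a::{metric_space, second_countable_topology} \<times> real) measure" +
  fixes \<eta> :: "'a \<Rightarrow> real" and V :: real
  assumes sets_P [measurable_cong]: "sets P = sets (borel \<Otimes>\<^sub>M borel)"
    and measurable_eta [measurable]: "\<eta> \<in> borel_measurable borel"
    and V_nonneg: "0 \<le> V"
    and noise_mean: "\<And>h. h \<in> borel_measurable borel \<Longrightarrow> (\<And>x. \<bar>h x\<bar> \<le> 1) \<Longrightarrow>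
      (\<integral>z. h (fst z) * (snd z - \<eta> (fst z)) \<partial>P) = 0"
    and noise_variance: "\<And>h. h \<in> borel_measurable borel \<Longrightarrow>
      (\<integral>\<^sup>+z. h (fst z) * ennreal ((snd z - \<eta> (fst z))\<^sup>2) \<partial>P) \<le> ennreal V * (\<integral>\<^sup>+z. h (fst z) \<partial>P)"
begin

definition noise :: "'a \<times> real \<Rightarrow> real" where
  "noise z = snd z - \<eta> (fst z)"

text \<open>The restriction to \<open>I\<close> makes the value a point of \<open>PiM I\<close>, on
  which weights and selections are measurable. Weights will be functions of this vector alone, which
  keeps the labels out of the choice of neighbors.\<close>

definition covariates :: "nat set \<Rightarrow> (nat \<Rightarrow> 'a \<times> real) \<Rightarrow> nat \<Rightarrow> 'a" where
  "covariates I D = (\<lambda>i\<in>I. fst (D i))"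

lemma measurable_noise [measurable]: "noise \<in> borel_measurable P"
  unfolding noise_def[abs_def] by measurable

lemma measurable_covariates [measurable]:
  "covariates I \<in> measurable (PiM I (\<lambda>_. P)) (PiM I (\<lambda>_. borel))"
  unfolding covariates_def[abs_def] by measurable

lemma product_prob_space_P: "product_prob_space (\<lambda>_ :: nat. P)"
  by unfold_locales

lemma space_P: "space P = UNIV"
  using sets_eq_imp_space_eq[OF sets_P] by (simp add: space_pair_measure)

lemma covariates_update:
  fixes I :: "nat set"
  assumes "i \<in> I"
  shows "covariates I (D(i := y)) = (covariates (I - {i}) D)(i := fst y)"
  using assms by (auto simp: covariates_def fun_eq_iff)

lemma measurable_covariates_section:
  fixes I :: "nat set"
  assumes "i \<in> I" "f \<in> borel_measurable (PiM I (\<lambda>_. borel))"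
  shows "(\<lambda>a. f ((covariates (I - {i}) D)(i := a))) \<in> borel_measurable borel"
proof -
  have "(\<lambda>a. (covariates (I - {i}) D)(i := a))
      \<in> measurable borel (PiM (insert i (I - {i})) (\<lambda>_. borel))"
    by (rule measurable_component_update[where M = "\<lambda>_. borel" and i = i and I = "I - {i}"])
      (auto simp: space_PiM covariates_def)
  then have "(\<lambda>a. (covariates (I - {i}) D)(i := a)) \<in> measurable borel (PiM I (\<lambda>_. borel))"
    using assms(1) by (simp add: insert_absorb)
  then show ?thesis
    by (rule measurable_compose[OF _ assms(2)])
qed

text \<open>Fubini integrates coordinate \<open>i\<close> first. With the other coordinates frozen,
  the weight sees only \<open>fst y\<close>, so the conditional variance bound applies to the inner
  integral.\<close>

lemma noise_weighted_variance:
  fixes I :: "nat set"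
  assumes I: "finite I" "i \<in> I" and [measurable]: "w \<in> borel_measurable (PiM I (\<lambda>_. borel))"
  shows "(\<integral>\<^sup>+D. w (covariates I D) * ennreal ((noise (D i))\<^sup>2) \<partial>PiM I (\<lambda>_. P))
    \<le> ennreal V * (\<integral>\<^sup>+D. w (covariates I D) \<partial>PiM I (\<lambda>_. P))"
proof -
  interpret product_prob_space "\<lambda>_ :: nat. P" by (rule product_prob_space_P)
  have ins: "insert i (I - {i}) = I" using I by auto
  have fin: "finite (I - {i})" "i \<notin> I - {i}" using I by auto
  note Fub = product_nn_integral_insert[OF fin, unfolded ins]
  have "(\<integral>\<^sup>+D. w (covariates I D) * ennreal ((noise (D i))\<^sup>2) \<partial>PiM I (\<lambda>_. P)) =
      (\<integral>\<^sup>+D. (\<integral>\<^sup>+y. w ((covariates (I - {i}) D)(i := fst y)) * ennreal ((noise y)\<^sup>2) \<partial>P) \<partial>PiM (I - {i}) (\<lambda>_. P))"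
    using I by (subst Fub) (auto simp: covariates_update)
  also have "\<dots> \<le> (\<integral>\<^sup>+D. ennreal V * (\<integral>\<^sup>+y. w ((covariates (I - {i}) D)(i := fst y)) \<partial>P) \<partial>PiM (I - {i}) (\<lambda>_. P))"
    unfolding noise_def
    by (intro nn_integral_mono noise_variance measurable_covariates_section I) simp
  also have "\<dots> = ennreal V * (\<integral>\<^sup>+D. (\<integral>\<^sup>+y. w (covariates I (D(i := y))) \<partial>P) \<partial>PiM (I - {i}) (\<lambda>_. P))"
  proof (subst nn_integral_cmult)
    \<comment> \<open>Pulling \<open>V\<close> out requires the inner integral to be measurable in
      the remaining coordinates; this comes from joint measurability of the coordinate
      update.\<close>
    have 1: "(\<lambda>(D, y). D(i := y)) \<in> measurable (PiM (I - {i}) (\<lambda>_. P) \<Otimes>\<^sub>M P) (PiM (insert i (I - {i})) (\<lambda>_. P))"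
      by (rule measurable_add_dim)
    have "(\<lambda>(D, y). w (covariates I (D(i := y)))) \<in> borel_measurable (PiM (I - {i}) (\<lambda>_. P) \<Otimes>\<^sub>M P)"
      using measurable_compose[OF 1[unfolded ins], of "\<lambda>D. w (covariates I D)" borel]
      by (simp add: case_prod_beta)
    then show "(\<lambda>D. \<integral>\<^sup>+y. w ((covariates (I - {i}) D)(i := fst y)) \<partial>P) \<in> borel_measurable (PiM (I - {i}) (\<lambda>_. P))"
      using I by (simp add: covariates_update cong: measurable_cong) measurable
  qed (use I in \<open>simp add: covariates_update\<close>)
  also have "(\<integral>\<^sup>+D. (\<integral>\<^sup>+y. w (covariates I (D(i := y))) \<partial>P) \<partial>PiM (I - {i}) (\<lambda>_. P)) =
     (\<integral>\<^sup>+D. w (covariates I D) \<partial>PiM I (\<lambda>_. P))"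
    by (rule Fub[symmetric]) simp
  finally show ?thesis .
qed

lemma noise_square_integrable:
  fixes I :: "nat set"
  assumes "finite I" "i \<in> I"
  shows "integrable (PiM I (\<lambda>_. P)) (\<lambda>D. (noise (D i))\<^sup>2)"
proof (rule integrableI_bounded)
  have "emeasure (PiM I (\<lambda>_. P)) (space (PiM I (\<lambda>_. P))) = 1"
    by (intro prob_space.emeasure_space_1 prob_space_PiM prob_space_axioms)
  moreover
  have "(\<integral>\<^sup>+D. 1 * ennreal ((noise (D i))\<^sup>2) \<partial>PiM I (\<lambda>_. P)) \<le> ennreal V * (\<integral>\<^sup>+D. 1 \<partial>PiM I (\<lambda>_. P))"
    by (rule noise_weighted_variance[OF assms]) simp
  ultimately show "(\<integral>\<^sup>+D. ennreal (norm ((noise (D i))\<^sup>2)) \<partial>PiM I (\<lambda>_. P)) < \<infinity>"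
    by (simp add: le_less_trans)
qed (use assms in measurable)

text \<open>A product of two noise terms is dominated by the sum of their squares. Both Fubini and
  the expansion of the squared sum below rely on this.\<close>

lemma weighted_noise_product_integrable:
  fixes I :: "nat set"
  assumes I: "finite I" "i \<in> I" "j \<in> I"
    and [measurable]: "w \<in> borel_measurable (PiM I (\<lambda>_. borel))" and w: "\<And>X. \<bar>w X\<bar> \<le> 1"
  shows "integrable (PiM I (\<lambda>_. P)) (\<lambda>D. w (covariates I D) * (noise (D i) * noise (D j)))"
proof (rule Bochner_Integration.integrable_bound)
  show "integrable (PiM I (\<lambda>_. P)) (\<lambda>D. (noise (D i))\<^sup>2 + (noise (D j))\<^sup>2)"
    using noise_square_integrable I by auto
  have "\<bar>w X * (a * b)\<bar> \<le> a\<^sup>2 + b\<^sup>2" for X and a b :: real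
  proof -
    have "\<bar>w X * (a * b)\<bar> \<le> 1 * \<bar>a * b\<bar>"
      unfolding abs_mult[of "w X"] by (intro mult_right_mono w) simp
    moreover have "2 * \<bar>a * b\<bar> \<le> a\<^sup>2 + b\<^sup>2"
      using sum_squares_bound[of "\<bar>a\<bar>" "\<bar>b\<bar>"] by (simp add: abs_mult mult.assoc)
    ultimately show ?thesis
      using abs_ge_zero[of "a * b"] by linarith
  qed
  then show "AE D in PiM I (\<lambda>_. P). norm (w (covariates I D) * (noise (D i) * noise (D j)))
      \<le> norm ((noise (D i))\<^sup>2 + (noise (D j))\<^sup>2)"
    by auto
qed (use I in measurable)

text \<open>With all coordinates but \<open>i\<close> frozen, \<open>noise (D j)\<close> is a
  constant because \<open>j\<close> differs from \<open>i\<close>, and the weight depends on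
  coordinate \<open>i\<close> through its covariate only. The inner integral is then zero by
  \<open>noise_mean\<close>.\<close>

lemma noise_orthogonal:
  fixes I :: "nat set"
  assumes I: "finite I" "i \<in> I" "j \<in> I" "i \<noteq> j"
    and w_meas [measurable]: "w \<in> borel_measurable (PiM I (\<lambda>_. borel))" and w: "\<And>X. \<bar>w X\<bar> \<le> 1"
  shows "(\<integral>D. w (covariates I D) * (noise (D i) * noise (D j)) \<partial>PiM I (\<lambda>_. P)) = 0"
proof -
  interpret product_prob_space "\<lambda>_ :: nat. P" by (rule product_prob_space_P)
  have ins: "insert i (I - {i}) = I" using I by auto
  have fin: "finite (I - {i})" "i \<notin> I - {i}" using I by auto
  have zero: "(\<integral>y. w ((covariates (I - {i}) D)(i := fst y)) * (noise y * b) \<partial>P) = 0" for D b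
  proof -
    have "(\<integral>y. w ((covariates (I - {i}) D)(i := fst y)) * (noise y * b) \<partial>P) =
       (\<integral>y. (w ((covariates (I - {i}) D)(i := fst y)) * (snd y - \<eta> (fst y))) * b \<partial>P)"
      by (simp add: noise_def mult.assoc)
    also have "\<dots> = (\<integral>y. w ((covariates (I - {i}) D)(i := fst y)) * (snd y - \<eta> (fst y)) \<partial>P) * b"
      by (rule integral_mult_left_zero)
    also have "\<dots> = 0"
      by (subst noise_mean[OF measurable_covariates_section[OF I(2) w_meas]]) (auto simp: w)
    finally show ?thesis .
  qed
  let ?f = "\<lambda>D. w (covariates I D) * (noise (D i) * noise (D j))"
  have "integrable (PiM (insert i (I - {i})) (\<lambda>_. P)) ?f"
    unfolding ins by (rule weighted_noise_product_integrable[OF I(1-3) w_meas w])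
  from product_integral_insert[OF fin this]
  have "integral\<^sup>L (PiM I (\<lambda>_. P)) ?f =
      (\<integral>D. (\<integral>y. ?f (D(i := y)) \<partial>P) \<partial>PiM (I - {i}) (\<lambda>_. P))"
    unfolding ins .
  also have "\<dots> = (\<integral>D. (\<integral>y. w ((covariates (I - {i}) D)(i := fst y)) * (noise y * noise (D j)) \<partial>P)
      \<partial>PiM (I - {i}) (\<lambda>_. P))"
    using I(2,4) by (simp add: covariates_update)
  finally show ?thesis by (simp add: zero)
qed

text \<open>Expanding the square leaves only the diagonal, by orthogonality. The expansion needs
  signed integrals; the diagonal then returns to \<open>ennreal\<close>, where the variance bound is
  available.\<close>

lemma weighted_noise_sum_second_moment:
  assumes I: "finite I" and w_meas: "\<And>i. i \<in> I \<Longrightarrow> w i \<in> borel_measurable (PiM I (\<lambda>_. borel))"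
    and w: "\<And>i X. \<bar>w i X\<bar> \<le> 1"
  shows "(\<integral>\<^sup>+D. ennreal ((\<Sum>i\<in>I. w i (covariates I D) * noise (D i))\<^sup>2) \<partial>PiM I (\<lambda>_. P))
    \<le> ennreal V * (\<integral>\<^sup>+D. ennreal (\<Sum>i\<in>I. (w i (covariates I D))\<^sup>2) \<partial>PiM I (\<lambda>_. P))"
proof -
  let ?Q = "PiM I (\<lambda>_. P)"
  have ww: "\<bar>w i X * w j X\<bar> \<le> 1" for i j X
    unfolding abs_mult by (intro mult_le_one w abs_ge_zero)
  have int: "integrable ?Q (\<lambda>D. (w i (covariates I D) * w j (covariates I D)) * (noise (D i) * noise (D j)))"
    if "i \<in> I" "j \<in> I" for i j
    using that
    by (intro weighted_noise_product_integrable[OF I that, of "\<lambda>X. w i X * w j X"] borel_measurable_times w_meas ww)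
  have square: "(\<Sum>i\<in>I. w i (covariates I D) * noise (D i))\<^sup>2 =
      (\<Sum>i\<in>I. \<Sum>j\<in>I. (w i (covariates I D) * w j (covariates I D)) * (noise (D i) * noise (D j)))" for D
    by (simp add: power2_eq_square sum_product mult_ac)
  have "(\<integral>D. (\<Sum>i\<in>I. w i (covariates I D) * noise (D i))\<^sup>2 \<partial>?Q) =
      (\<Sum>i\<in>I. \<Sum>j\<in>I. \<integral>D. (w i (covariates I D) * w j (covariates I D)) * (noise (D i) * noise (D j)) \<partial>?Q)"
    unfolding square using int by (simp add: Bochner_Integration.integral_sum)
  \<comment> \<open>The product of the two weights is itself a bounded function of the covariates,
    so it serves as the weight in \<open>noise_orthogonal\<close>.\<close>
  also have "\<dots> = (\<Sum>i\<in>I. \<Sum>j\<in>I. if i = j then \<integral>D. (w i (covariates I D))\<^sup>2 * (noise (D i))\<^sup>2 \<partial>?Q else 0)"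
    using ww by (intro sum.cong refl)
      (auto simp: power2_eq_square intro!: noise_orthogonal[where w = "\<lambda>X. w _ X * w _ X"] I borel_measurable_times w_meas)
  also have "\<dots> = (\<Sum>i\<in>I. \<integral>D. (w i (covariates I D))\<^sup>2 * (noise (D i))\<^sup>2 \<partial>?Q)"
    using I by simp
  finally have eq: "(\<integral>D. (\<Sum>i\<in>I. w i (covariates I D) * noise (D i))\<^sup>2 \<partial>?Q) = \<dots>" .
  have "integrable ?Q (\<lambda>D. (\<Sum>i\<in>I. w i (covariates I D) * noise (D i))\<^sup>2)"
    unfolding square using int by auto
  then have "(\<integral>\<^sup>+D. ennreal ((\<Sum>i\<in>I. w i (covariates I D) * noise (D i))\<^sup>2) \<partial>?Q) =
      (\<Sum>i\<in>I. ennreal (\<integral>D. (w i (covariates I D))\<^sup>2 * (noise (D i))\<^sup>2 \<partial>?Q))"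
    by (simp add: nn_integral_eq_integral eq sum_ennreal)
  also have "\<dots> = (\<Sum>i\<in>I. \<integral>\<^sup>+D. ennreal ((w i (covariates I D))\<^sup>2) * ennreal ((noise (D i))\<^sup>2) \<partial>?Q)"
  proof (rule sum.cong[OF refl])
    fix i assume "i \<in> I"
    then have "integrable ?Q (\<lambda>D. (w i (covariates I D))\<^sup>2 * (noise (D i))\<^sup>2)"
      using int[of i i] by (simp add: power2_eq_square)
    then show "ennreal (\<integral>D. (w i (covariates I D))\<^sup>2 * (noise (D i))\<^sup>2 \<partial>?Q) =
      (\<integral>\<^sup>+D. ennreal ((w i (covariates I D))\<^sup>2) * ennreal ((noise (D i))\<^sup>2) \<partial>?Q)"
      by (simp add: nn_integral_eq_integral[symmetric] ennreal_mult)
  qed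
  also have "\<dots> \<le> (\<Sum>i\<in>I. ennreal V * (\<integral>\<^sup>+D. ennreal ((w i (covariates I D))\<^sup>2) \<partial>?Q))"
    using w_meas by (intro sum_mono noise_weighted_variance[OF I]) auto
  also have "\<dots> = ennreal V * (\<integral>\<^sup>+D. (\<Sum>i\<in>I. ennreal ((w i (covariates I D))\<^sup>2)) \<partial>?Q)"
    using w_meas by (subst nn_integral_sum) (auto simp: sum_distrib_left)
  finally show ?thesis by (simp add: sum_ennreal)
qed

end

text \<open>A point outside the support has a null ball and hence a null basis set around it; a
  countable basis makes the union of all null basis sets null. Homogeneity speaks only about points
  of the support, and this lemma makes it usable for almost every query point.\<close>

lemma AE_support:
  fixes \<mu> :: "'a::{metric_space, second_countable_topology} measure"
  assumes "finite_measure \<mu>" and sets: "sets \<mu> = sets borel"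
  shows "AE x in \<mu>. x \<in> support \<mu>"
proof -
  interpret finite_measure \<mu> by fact
  obtain B :: "'a set set" where B: "countable B" "topological_basis B"
    using ex_countable_basis by blast
  define N where "N = \<Union>{b \<in> B. emeasure \<mu> b = 0}"
  have "N \<in> null_sets \<mu>"
    unfolding N_def using B sets topological_basis_open[OF B(2)]
    by (intro null_sets_UN'[of _ "\<lambda>x. x", simplified]) (auto simp: null_sets_def)
  moreover have "x \<in> N" if "x \<notin> support \<mu>" for x
  proof -
    from that obtain r where r: "r > 0" "measure \<mu> (ball x r) = 0"
      unfolding support_def using zero_less_measure_iff by force
    obtain b where b: "b \<in> B" "x \<in> b" "b \<subseteq> ball x r"
      using topological_basisE[OF B(2) open_ball, of x x r] r by auto
    have "emeasure \<mu> b \<le> emeasure \<mu> (ball x r)"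
      using b sets by (intro emeasure_mono) auto
    then show ?thesis
      using b r by (auto simp: N_def emeasure_eq_measure)
  qed
  ultimately show ?thesis
    by (intro AE_I'[of N]) auto
qed

section \<open>Moments of nearest neighbor distances\<close>

text \<open>A point strictly below \<open>f i\<close> cannot have been left out while
  \<open>i\<close> was chosen, so all points below \<open>t\<close> lie in \<open>J - {i}\<close>.
  The strict inequality makes this independent of how ties are broken.\<close>

lemma k_smallest_few_below:
  assumes J: "k_smallest k B f J" and "finite B" "i \<in> J" "t \<le> f i"
  shows "card {j \<in> B. f j < t} < k"
proof -
  have "{j \<in> B. f j < t} \<subseteq> J - {i}"
    using assms unfolding k_smallest_def by force
  moreover have fin: "finite J"
    using J \<open>finite B\<close> unfolding k_smallest_def by (auto intro: finite_subset)
  ultimately have "card {j \<in> B. f j < t} \<le> card (J - {i})"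
    by (intro card_mono) auto
  also have "\<dots> < card J"
    using fin \<open>i \<in> J\<close> by (intro psubset_card_mono) auto
  finally show ?thesis
    using J by (simp add: k_smallest_def)
qed

text \<open>
  With \<open>U = f(i)\<^sup>d / \<rho>\<close>, the power \<open>U\<^sup>\<beta>\<close> is at most \<open>(j + 1)\<^sup>\<beta>\<close> for \<open>j = \<lfloor>U\<rfloor>\<close>, and the ball of radius
  \<open>(j \<rho>)\<^bsup>1/d\<^esup> \<le> f(i)\<close> contains fewer than \<open>k\<close> points.
\<close>

lemma k_smallest_powr_le:
  assumes J: "k_smallest k B f J" "finite B" "i \<in> J" and f: "0 \<le> f i"
    and pos: "0 < \<rho>" "0 < d" "0 < \<beta>"
  shows "ennreal (f i powr (d * \<beta>)) \<le> ennreal (\<rho> powr \<beta>) *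
    (\<Sum>j. ennreal (real (j + 1) powr \<beta>) *
      of_bool (card {l \<in> B. f l < (real j * \<rho>) powr (1 / d)} < k))"
proof -
  define U where "U = f i powr d / \<rho>"
  define j where "j = nat \<lfloor>U\<rfloor>"
  have U: "0 \<le> U" "real j \<le> U" "U \<le> real (j + 1)"
    using pos unfolding U_def j_def by (auto intro: order.trans[OF of_nat_floor]) linarith
  have "(real j * \<rho>) powr (1 / d) \<le> (f i powr d) powr (1 / d)"
    using U pos by (intro powr_mono2) (auto simp: U_def field_simps)
  also have "\<dots> = f i"
    using f pos by (simp add: powr_powr)
  finally have few: "card {l \<in> B. f l < (real j * \<rho>) powr (1 / d)} < k"
    by (rule k_smallest_few_below[OF J])
  have "f i powr (d * \<beta>) = (\<rho> * U) powr \<beta>"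
    using pos by (simp add: U_def powr_powr)
  also have "\<dots> \<le> \<rho> powr \<beta> * real (j + 1) powr \<beta>"
    using U pos by (subst powr_mult) (auto intro!: mult_left_mono powr_mono2)
  finally have "ennreal (f i powr (d * \<beta>)) \<le> ennreal (\<rho> powr \<beta>) * (ennreal (real (j + 1) powr \<beta>) *
      of_bool (card {l \<in> B. f l < (real j * \<rho>) powr (1 / d)} < k))"
    using few by (simp add: ennreal_mult[symmetric] ennreal_leI)
  also have "\<dots> \<le> ennreal (\<rho> powr \<beta>) * (\<Sum>j. ennreal (real (j + 1) powr \<beta>) *
      of_bool (card {l \<in> B. f l < (real j * \<rho>) powr (1 / d)} < k))"
    using sum_le_suminf[of "\<lambda>j. ennreal (real (j + 1) powr \<beta>) *
      of_bool (card {l \<in> B. f l < (real j * \<rho>) powr (1 / d)} < k)" "{j}"]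
    by (intro mult_left_mono) auto
  finally show ?thesis .
qed

text \<open>The constant left over when distances are cut into layers: the first factor bounds the
  normalized power on layer \<open>j\<close>, the second is the bound of
  \<open>few_in_ball_tail\<close> for the probability of reaching that layer.\<close>

definition tail_series :: "real \<Rightarrow> real" where
  "tail_series \<beta> = (\<Sum>j. real (j + 1) powr \<beta> * exp (1 - real j / 4))"

lemma summable_tail_series: "summable (\<lambda>j. real (j + 1) powr \<beta> * exp (1 - real j / 4))"
proof (rule summable_comparison_test_bigo)
  show "summable (\<lambda>j. norm (1 / real j ^ 2))"
    using inverse_power_summable[of 2, where ?'a = real] by (simp add: field_simps)
  show "(\<lambda>j. real (j + 1) powr \<beta> * exp (1 - real j / 4)) \<in> O(\<lambda>j. 1 / real j ^ 2)"
    by real_asymp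
qed

lemma tail_series_nonneg: "0 \<le> tail_series \<beta>"
  unfolding tail_series_def by (intro suminf_nonneg summable_tail_series) auto

section \<open>Chernoff bounds for the number of sample points in a ball\<close>

context regression_model
begin

lemma prob_space_PiM_P: "prob_space (PiM I (\<lambda>_ :: nat. P))"
  by (intro prob_space_PiM prob_space_axioms)

lemma measure_marginal_ball:
  "measure (marginal P) (ball x t) = prob {z. dist x (fst z) < t}"
proof -
  have "fst \<in> measurable P borel" by measurable
  then show ?thesis
    unfolding marginal_def by (subst measure_distr) (auto simp: space_P vimage_def ball_def)
qed

lemma measurable_few_in_ball:
  fixes B I :: "nat set"
  assumes "B \<subseteq> I"
  shows "(\<lambda>D. of_bool (card {i \<in> B. dist x (fst (D i)) < t} < k) :: ennreal) \<in> borel_measurable (PiM I (\<lambda>_. P))"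
proof -
  have "{D \<in> space (PiM I (\<lambda>_. P)). i \<in> {i \<in> B. dist x (fst (D i)) < t}} \<in> sets (PiM I (\<lambda>_. P))" for i
  proof (cases "i \<in> B")
    case True
    with assms have [measurable]: "i \<in> I" by auto
    have "{D \<in> space (PiM I (\<lambda>_. P)). dist x (fst (D i)) < t} \<in> sets (PiM I (\<lambda>_. P))"
      by measurable
    with True show ?thesis by simp
  qed simp
  then have "(\<lambda>D. card {i \<in> B. dist x (fst (D i)) < t}) \<in> measurable (PiM I (\<lambda>_. P)) (count_space UNIV)"
    by (rule measurable_card)
  then show ?thesis
    by (rule measurable_compose[where g = "\<lambda>c. of_bool (c < k)"]) simp
qed

text \<open>Exponential Markov inequality: the indicator is at most
  \<open>exp (l * (k - count))\<close>, and independence turns the mean of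
  \<open>exp (- l * count)\<close> into a power of the Laplace transform
  \<open>1 - p * (1 - exp (- l))\<close> of a Bernoulli variable. The parameter \<open>l\<close>
  stays free because two regimes need different values.\<close>

lemma few_in_ball_chernoff:
  fixes I B :: "nat set" and x :: 'a and t l :: real
  assumes I: "finite I" "B \<subseteq> I" and l: "0 \<le> l"
  defines "p \<equiv> measure (marginal P) (ball x t)"
  shows "(\<integral>\<^sup>+D. of_bool (card {i \<in> B. dist x (fst (D i)) < t} < k) \<partial>PiM I (\<lambda>_. P))
    \<le> ennreal (exp (l * real k) * (1 - p * (1 - exp (- l))) ^ card B)"
proof -
  interpret Q: product_prob_space "\<lambda>_ :: nat. P" by (rule product_prob_space_P)
  define E where "E = {z :: 'a \<times> real. dist x (fst z) < t}"
  have [measurable]: "E \<in> sets P"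
  proof -
    have "{z \<in> space P. dist x (fst z) < t} \<in> sets P" by measurable
    then show ?thesis by (simp add: E_def space_P)
  qed
  \<comment> \<open>The factors are 1 off \<open>B\<close>, so that the product over all of
    \<open>I\<close>, as required for the product measure, equals the product over
    \<open>B\<close>.\<close>
  define g where "g i z = ennreal (if i \<in> B then 1 - indicator E z * (1 - exp (- l)) else 1)"
    for i :: nat and z
  have p: "p = prob E" unfolding p_def E_def by (rule measure_marginal_ball)
  have finB: "finite B" using I finite_subset by blast
  have le1: "indicator E z * (1 - exp (- l)) \<le> 1" for z
    using l by (auto simp: indicator_def)
  have "of_bool (card {i \<in> B. dist x (fst (D i)) < t} < k)
      \<le> ennreal (exp (l * real k)) * (\<Prod>i\<in>I. g i (D i))" for D
  proof -
    have "(\<Prod>i\<in>I. g i (D i)) = (\<Prod>i\<in>B. g i (D i))"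
      using I by (intro prod.mono_neutral_right) (auto simp: g_def)
    also have "\<dots> = (\<Prod>i\<in>B. ennreal (if D i \<in> E then exp (- l) else 1))"
      by (intro prod.cong) (auto simp: g_def)
    also have "\<dots> = ennreal (\<Prod>i\<in>B. if D i \<in> E then exp (- l) else 1)"
      by (rule prod_ennreal) auto
    also have "(\<Prod>i\<in>B. if D i \<in> E then exp (- l) else 1) = exp (- l) ^ card {i \<in> B. D i \<in> E}"
      using finB by (simp add: prod.If_cases Int_def)
    finally have "(\<Prod>i\<in>I. g i (D i)) = ennreal (exp (- l * real (card {i \<in> B. dist x (fst (D i)) < t})))"
      by (simp add: exp_of_nat_mult[symmetric] E_def mult.commute)
    moreover have "1 \<le> exp (l * real k) * exp (- l * real (card {i \<in> B. dist x (fst (D i)) < t}))"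
      if "card {i \<in> B. dist x (fst (D i)) < t} < k"
      using that l by (simp add: exp_add[symmetric] mult_left_mono)
    ultimately show ?thesis
      by (auto simp: ennreal_mult[symmetric] simp flip: ennreal_1 intro!: ennreal_leI)
  qed
  then have "(\<integral>\<^sup>+D. of_bool (card {i \<in> B. dist x (fst (D i)) < t} < k) \<partial>PiM I (\<lambda>_. P))
      \<le> (\<integral>\<^sup>+D. ennreal (exp (l * real k)) * (\<Prod>i\<in>I. g i (D i)) \<partial>PiM I (\<lambda>_. P))"
    by (intro nn_integral_mono)
  also have "\<dots> = ennreal (exp (l * real k)) * (\<integral>\<^sup>+D. (\<Prod>i\<in>I. g i (D i)) \<partial>PiM I (\<lambda>_. P))"
    by (rule nn_integral_cmult) (unfold g_def, measurable)
  also have "(\<integral>\<^sup>+D. (\<Prod>i\<in>I. g i (D i)) \<partial>PiM I (\<lambda>_. P)) = (\<Prod>i\<in>I. \<integral>\<^sup>+z. g i z \<partial>P)"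
    using I by (intro Q.product_nn_integral_prod) (auto simp: g_def)
  also have "\<dots> = (\<Prod>i\<in>B. \<integral>\<^sup>+z. g i z \<partial>P)"
    using I by (intro prod.mono_neutral_right) (auto simp: g_def emeasure_space_1)
  also have "\<dots> = (\<Prod>i\<in>B. ennreal (1 - p * (1 - exp (- l))))"
  proof (rule prod.cong[OF refl])
    fix i assume "i \<in> B"
    then have "(\<integral>\<^sup>+z. g i z \<partial>P) = (\<integral>\<^sup>+z. ennreal (1 - indicator E z * (1 - exp (- l))) \<partial>P)"
      by (simp add: g_def)
    also have "\<dots> = ennreal (\<integral>z. 1 - indicator E z * (1 - exp (- l)) \<partial>P)"
    proof (rule nn_integral_eq_integral)
      show "integrable P (\<lambda>z. 1 - indicator E z * (1 - exp (- l)))"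
        by (simp add: less_top[symmetric])
    qed (use le1 in auto)
    also have "(\<integral>z. 1 - indicator E z * (1 - exp (- l)) \<partial>P) = 1 - p * (1 - exp (- l))"
    proof -
      have "integrable P (\<lambda>z. indicator E z * (1 - exp (- l)))"
        by (simp add: less_top[symmetric])
      then show ?thesis
        by (subst Bochner_Integration.integral_diff) (auto simp: p prob_space)
    qed
    finally show "(\<integral>\<^sup>+z. g i z \<partial>P) = ennreal (1 - p * (1 - exp (- l)))" .
  qed
  also have "\<dots> = ennreal ((1 - p * (1 - exp (- l))) ^ card B)"
  proof -
    have "p * (1 - exp (- l)) \<le> 1"
      using l prob_le_1[of E] by (intro mult_le_one) (auto simp: p)
    then show ?thesis by (simp add: ennreal_power)
  qed
  finally show ?thesis by (simp add: ennreal_mult')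
qed

text \<open>The radius is chosen so that homogeneity gives the ball mass at least
  \<open>min (j * k / card B) 1\<close>. Up to that cap, the expected count is at least
  \<open>j * k\<close>, and seeing fewer than \<open>k\<close> points has probability exponentially
  small in \<open>j\<close>, uniformly in \<open>k\<close>.\<close>

lemma few_in_ball_tail:
  fixes I B :: "nat set" and x :: 'a
  assumes I: "finite I" "B \<subseteq> I" and hom: "homogeneous (marginal P) C d" "x \<in> support (marginal P)"
    and pos: "0 < C" "0 < d" and k: "1 \<le> k" "k + 1 \<le> card B"
  shows "(\<integral>\<^sup>+D. of_bool (card {i \<in> B. dist x (fst (D i)) < (real j * (real k / (real (card B) * C))) powr (1 / d)} < k)
      \<partial>PiM I (\<lambda>_. P)) \<le> ennreal (exp (1 - real j / 4))"
proof (cases "j \<le> 4")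
  \<comment> \<open>The claimed bound is at least 1 here, so it holds for any probability.\<close>
  case True
  interpret Q: prob_space "PiM I (\<lambda>_. P)" by (rule prob_space_PiM_P)
  have "(\<integral>\<^sup>+D. of_bool (card {i \<in> B. dist x (fst (D i)) < (real j * (real k / (real (card B) * C))) powr (1 / d)} < k)
      \<partial>PiM I (\<lambda>_. P)) \<le> (\<integral>\<^sup>+D. 1 \<partial>PiM I (\<lambda>_. P))"
    by (intro nn_integral_mono) auto
  also have "\<dots> \<le> ennreal (exp (1 - real j / 4))"
    using True ennreal_leI[of 1 "exp (1 - real j / 4)"] by (simp add: Q.emeasure_space_1)
  finally show ?thesis .
next
  case False
  define n where "n = card B"
  define t where "t = (real j * (real k / (real n * C))) powr (1 / d)"
  define p where "p = measure (marginal P) (ball x t)"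
  have n: "0 < n" "k + 1 \<le> n" using k by (auto simp: n_def)
  have "0 < t" unfolding t_def using pos k n False by auto
  then have "min (C * t powr d) 1 \<le> p"
    using hom unfolding homogeneous_def p_def by auto
  moreover have "C * t powr d = real j * real k / real n"
    using pos n by (simp add: t_def powr_powr)
  ultimately have p: "min (real j * real k / real n) 1 \<le> p" by simp
  have p1: "p \<le> 1"
    unfolding p_def measure_marginal_ball by (rule prob_le_1)
  note chernoff = few_in_ball_chernoff[OF I, of _ x t k, folded p_def n_def]
  show ?thesis
  proof (cases "real n \<le> real j * real k")
    \<comment> \<open>The ball has full mass, so all \<open>n\<close> points fall into it almost
      surely. Taking \<open>l = j\<close>, the gap \<open>k + 1 \<le> n\<close> leaves
      \<open>exp (- j)\<close>.\<close>
    case True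
    with p p1 n have "p = 1" by (simp add: min_def split: if_splits)
    have "(1 - p * (1 - exp (- real j))) ^ n = exp (- (real n * real j))"
      by (simp add: \<open>p = 1\<close> exp_of_nat_mult[symmetric])
    then have "exp (real j * real k) * (1 - p * (1 - exp (- real j))) ^ n = exp (- (real j * (real n - real k)))"
      by (simp add: exp_add[symmetric] algebra_simps)
    also have "\<dots> \<le> exp (- real j)"
      using n mult_left_mono[of 1 "real n - real k" "real j"] by simp
    also have "\<dots> \<le> exp (1 - real j / 4)" by simp
    finally show ?thesis
      using order.trans[OF chernoff[of "real j"] ennreal_leI] unfolding t_def n_def by simp
  next
    \<comment> \<open>Now \<open>l = 1\<close>: since \<open>1 - exp (- 1)\<close> is at least
      \<open>1 / 2\<close>, each point contributes a factor of at most
      \<open>exp (- j * k / (2 * n))\<close>.\<close>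
    case False
    with p n have p': "real j * real k / real n \<le> p" by (simp add: min_def split: if_splits)
    have half: "1 / 2 \<le> 1 - exp (- 1 :: real)"
      using exp_ge_add_one_self[of 1] by (simp add: exp_minus field_simps)
    have "1 - p * (1 - exp (- 1)) \<le> exp (- (p * (1 - exp (- 1))))"
      using exp_ge_add_one_self[of "- (p * (1 - exp (- 1)))"] by simp
    also have "\<dots> \<le> exp (- (real j * real k / real n / 2))"
      using mult_mono[OF p' half] p' by (simp add: order.trans[OF _ p'])
    finally have "(1 - p * (1 - exp (- 1))) ^ n \<le> exp (- (real j * real k / real n / 2)) ^ n"
      using p1 half by (intro power_mono) (auto intro!: mult_le_one)
    also have "\<dots> = exp (- (real j * real k / 2))"
      using n by (simp add: exp_of_nat_mult[symmetric])
    finally have "exp (1 * real k) * (1 - p * (1 - exp (- 1))) ^ n \<le> exp (1 * real k) * exp (- (real j * real k / 2))"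
      by (intro mult_left_mono) auto
    also have "\<dots> = exp (real k * (1 - real j / 2))"
      by (simp add: exp_add[symmetric] algebra_simps)
    also have "\<dots> \<le> exp (1 - real j / 4)"
    proof -
      \<comment> \<open>The factor \<open>1 - j / 2\<close> is negative for \<open>j > 4\<close>, so
        \<open>k = 1\<close> is the worst case.\<close>
      have "real k * (1 - real j / 2) \<le> 1 * (1 - real j / 2)"
        using k \<open>\<not> j \<le> 4\<close> by (intro mult_right_mono_neg) auto
      also have "\<dots> \<le> 1 - real j / 4" using \<open>\<not> j \<le> 4\<close> by simp
      finally show ?thesis unfolding exp_le_cancel_iff .
    qed
    finally show ?thesis
      using order.trans[OF chernoff[of 1] ennreal_leI] unfolding t_def n_def by simp
  qed
qed

text \<open>The layer bound of \<open>k_smallest_powr_le\<close> is the same for every chosen index,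
  so the sum over the sample-dependent neighbor set is at most \<open>k\<close> times it.
  Integrating the series termwise with the tail bound gives \<open>tail_series\<close>. Writing the
  exponent as \<open>d * \<beta>\<close> turns the distance scale into a plain power of the ratio
  \<open>k / (card B * C)\<close>.\<close>

lemma neighbor_distance_moment:
  fixes I B :: "nat set" and x :: 'a
  assumes I: "finite I" "B \<subseteq> I" and hom: "homogeneous (marginal P) C d" "x \<in> support (marginal P)"
    and pos: "0 < C" "0 < d" "0 < \<beta>" and k: "1 \<le> k" "k + 1 \<le> card B"
    and nb: "\<And>D. k_smallest k B (\<lambda>i. dist x (fst (D i))) (nb D)"
  shows "(\<integral>\<^sup>+D. (\<Sum>i\<in>nb D. ennreal (dist x (fst (D i)) powr (d * \<beta>))) \<partial>PiM I (\<lambda>_. P))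
    \<le> ennreal (real k * ((real k / (real (card B) * C)) powr \<beta> * tail_series \<beta>))"
proof -
  define \<rho> where "\<rho> = real k / (real (card B) * C)"
  have "0 < \<rho>" using pos k by (simp add: \<rho>_def)
  have finB: "finite B" using I finite_subset by blast
  define T where "T j D = (of_bool (card {l \<in> B. dist x (fst (D l)) < (real j * \<rho>) powr (1 / d)} < k) :: ennreal)"
    for j and D :: "nat \<Rightarrow> 'a \<times> real"
  have [measurable]: "T j \<in> borel_measurable (PiM I (\<lambda>_. P))" for j
    unfolding T_def by (rule measurable_few_in_ball[OF I(2)])
  have "(\<Sum>i\<in>nb D. ennreal (dist x (fst (D i)) powr (d * \<beta>)))
      \<le> of_nat k * (ennreal (\<rho> powr \<beta>) * (\<Sum>j. ennreal (real (j + 1) powr \<beta>) * T j D))" for D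
  proof -
    have "(\<Sum>i\<in>nb D. ennreal (dist x (fst (D i)) powr (d * \<beta>)))
      \<le> of_nat (card (nb D)) * (ennreal (\<rho> powr \<beta>) * (\<Sum>j. ennreal (real (j + 1) powr \<beta>) * T j D))"
      unfolding T_def using pos \<open>0 < \<rho>\<close>
      by (intro sum_bounded_above k_smallest_powr_le[OF nb finB]) auto
    then show ?thesis
      using nb[of D] by (simp add: k_smallest_def)
  qed
  then have "(\<integral>\<^sup>+D. (\<Sum>i\<in>nb D. ennreal (dist x (fst (D i)) powr (d * \<beta>))) \<partial>PiM I (\<lambda>_. P))
      \<le> (\<integral>\<^sup>+D. of_nat k * (ennreal (\<rho> powr \<beta>) * (\<Sum>j. ennreal (real (j + 1) powr \<beta>) * T j D)) \<partial>PiM I (\<lambda>_. P))"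
    by (rule nn_integral_mono)
  also have "\<dots> = of_nat k * (ennreal (\<rho> powr \<beta>) *
      (\<Sum>j. ennreal (real (j + 1) powr \<beta>) * (\<integral>\<^sup>+D. T j D \<partial>PiM I (\<lambda>_. P))))"
    by (simp add: nn_integral_cmult nn_integral_suminf)
  also have "\<dots> \<le> of_nat k * (ennreal (\<rho> powr \<beta>) *
      (\<Sum>j. ennreal (real (j + 1) powr \<beta>) * ennreal (exp (1 - real j / 4))))"
    unfolding T_def \<rho>_def
    by (intro mult_left_mono suminf_le few_in_ball_tail[OF I hom pos(1,2) k]) auto
  also have "(\<Sum>j. ennreal (real (j + 1) powr \<beta>) * ennreal (exp (1 - real j / 4))) = ennreal (tail_series \<beta>)"
    unfolding tail_series_def using summable_tail_series[of \<beta>]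
    by (subst suminf_ennreal2[symmetric]) (auto simp: ennreal_mult)
  also have "of_nat k * (ennreal (\<rho> powr \<beta>) * ennreal (tail_series \<beta>)) =
      ennreal (real k * (\<rho> powr \<beta> * tail_series \<beta>))"
    by (simp add: ennreal_mult tail_series_nonneg ennreal_of_nat_eq_real_of_nat)
  finally show ?thesis unfolding \<rho>_def .
qed

end

section \<open>Bias and variance of the selective rule\<close>

text \<open>A sum over a random index set is a sum over the fixed set \<open>I\<close> of terms
  switched on by measurable events.\<close>

lemma borel_measurable_random_sum:
  fixes f :: "'i \<Rightarrow> 'b \<Rightarrow> 'c::{second_countable_topology, topological_comm_monoid_add}"
  assumes "finite I" "\<And>x. x \<in> space M \<Longrightarrow> S x \<subseteq> I"
    and "\<And>i. i \<in> I \<Longrightarrow> {x \<in> space M. i \<in> S x} \<in> sets M"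
    and "\<And>i. i \<in> I \<Longrightarrow> f i \<in> borel_measurable M"
  shows "(\<lambda>x. \<Sum>i\<in>S x. f i x) \<in> borel_measurable M"
proof -
  have "(\<lambda>x. \<Sum>i\<in>I. if i \<in> S x then f i x else 0) \<in> borel_measurable M"
    using assms by (intro borel_measurable_sum measurable_If) auto
  moreover have "(\<Sum>i\<in>I. if i \<in> S x then f i x else 0) = (\<Sum>i\<in>S x. f i x)" if "x \<in> space M" for x
    using assms(1,2) that by (subst sum.inter_restrict[symmetric]) (auto simp: Int_absorb1)
  ultimately show ?thesis by (simp cong: measurable_cong)
qed

lemma k_smallest_cong:
  assumes "k_smallest k I f J" "\<And>i. i \<in> I \<Longrightarrow> f i = g i"
  shows "k_smallest k I g J"
  using assms unfolding k_smallest_def by (metis DiffD1 subsetD)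

text \<open>Flattens the two-level choice of blocks and of neighbors within blocks into one index
  set. Membership of \<open>i\<close> is decided by its own block \<open>s i\<close> alone, which
  makes it a measurable event and prevents double counting.\<close>

definition selected :: "nat \<Rightarrow> (nat \<Rightarrow> nat) \<Rightarrow> nat set \<Rightarrow> (nat \<Rightarrow> nat set) \<Rightarrow> nat set" where
  "selected N s S nb = {i \<in> {..<N}. s i \<in> S \<and> i \<in> nb (s i)}"

lemma sum_selected:
  assumes "finite S" and nb: "\<And>m. m \<in> S \<Longrightarrow> nb m \<subseteq> block N s m"
  shows "(\<Sum>i\<in>selected N s S nb. f i) = (\<Sum>m\<in>S. \<Sum>i\<in>nb m. f i)"
proof -
  have fin: "finite (nb m)" if "m \<in> S" for m
    using nb[OF that] by (rule finite_subset) (simp add: block_def)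
  have "selected N s S nb = (\<Union>m\<in>S. nb m)"
    using nb by (auto simp: selected_def block_def)
  moreover have "nb m \<inter> nb m' = {}" if "m \<in> S" "m' \<in> S" "m \<noteq> m'" for m m'
    using nb[OF that(1)] nb[OF that(2)] that(3) by (auto simp: block_def)
  ultimately show ?thesis
    using assms(1) fin by (simp add: sum.UNION_disjoint)
qed

text \<open>The error splits into a noise average and a bias average. Cauchy-Schwarz is applied to
  the bias only; the noise sum stays inside its square, so that orthogonality can still be
  used.\<close>

lemma average_error_square_le:
  fixes y h r :: "'i \<Rightarrow> real"
  assumes J: "finite J" "J \<noteq> {}"
    and h: "\<And>i. i \<in> J \<Longrightarrow> \<bar>h i - e\<bar> \<le> A * r i powr \<alpha>"
  shows "((\<Sum>i\<in>J. y i) / real (card J) - e)\<^sup>2 \<le>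
    2 / (real (card J))\<^sup>2 * (\<Sum>i\<in>J. y i - h i)\<^sup>2 + 2 * A\<^sup>2 / real (card J) * (\<Sum>i\<in>J. r i powr (2 * \<alpha>))"
proof -
  define K where "K = real (card J)"
  have K: "0 < K" using J by (simp add: K_def card_gt_0_iff)
  define a where "a = (\<Sum>i\<in>J. y i - h i)"
  define b where "b = (\<Sum>i\<in>J. h i - e)"
  have "(\<Sum>i\<in>J. y i) = a + b + K * e"
    by (simp add: a_def b_def K_def sum_subtractf)
  then have "(\<Sum>i\<in>J. y i) / K - e = (a + b) / K"
    using K by (simp add: field_simps)
  then have "((\<Sum>i\<in>J. y i) / K - e)\<^sup>2 = (a + b)\<^sup>2 / K\<^sup>2"
    by (simp add: power_divide)
  also have "\<dots> \<le> (2 * a\<^sup>2 + 2 * b\<^sup>2) / K\<^sup>2"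
    using sum_squares_bound[of a b] by (intro divide_right_mono) (simp_all add: power2_sum)
  also have "b\<^sup>2 \<le> (\<Sum>i\<in>J. (h i - e)\<^sup>2) * K"
    unfolding b_def K_def by (rule sum_squared_le_sum_of_squares)
  also have "(\<Sum>i\<in>J. (h i - e)\<^sup>2) \<le> (\<Sum>i\<in>J. A\<^sup>2 * r i powr (2 * \<alpha>))"
  proof (rule sum_mono)
    fix i assume "i \<in> J"
    have "(h i - e)\<^sup>2 \<le> (A * r i powr \<alpha>)\<^sup>2"
      using power_mono[OF h[OF \<open>i \<in> J\<close>] abs_ge_zero, of 2] by simp
    also have "\<dots> = A\<^sup>2 * r i powr (2 * \<alpha>)"
      by (simp add: power_mult_distrib power2_eq_square powr_add[symmetric])
    finally show "(h i - e)\<^sup>2 \<le> A\<^sup>2 * r i powr (2 * \<alpha>)" .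
  qed
  finally have "((\<Sum>i\<in>J. y i) / K - e)\<^sup>2 \<le> (2 * a\<^sup>2 + 2 * ((\<Sum>i\<in>J. A\<^sup>2 * r i powr (2 * \<alpha>)) * K)) / K\<^sup>2"
    using K by (simp add: divide_right_mono mult_right_mono)
  also have "\<dots> = 2 / K\<^sup>2 * a\<^sup>2 + 2 * A\<^sup>2 / K * (\<Sum>i\<in>J. r i powr (2 * \<alpha>))"
    using K by (simp add: sum_distrib_left[symmetric] field_simps power2_eq_square)
  finally show ?thesis by (simp add: K_def a_def)
qed

text \<open>The inequality of arithmetic and geometric means linearizes the root. The right-hand
  side is affine in the squared norm, so it can be averaged over the sample and treated by Fubini in
  place of Jensen's inequality.\<close>

lemma L2_norm_le:
  assumes "0 < b"
  shows "ennreal (L2_norm \<mu> h) \<le> ennreal (1 / (2 * b)) * (\<integral>\<^sup>+x. ennreal ((h x)\<^sup>2) \<partial>\<mu>) + ennreal (b / 2)"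
proof -
  define q where "q = (\<integral>x. \<bar>h x\<bar>\<^sup>2 \<partial>\<mu>)"
  have q: "0 \<le> q" "ennreal q \<le> (\<integral>\<^sup>+x. ennreal ((h x)\<^sup>2) \<partial>\<mu>)"
  proof -
    show "ennreal q \<le> (\<integral>\<^sup>+x. ennreal ((h x)\<^sup>2) \<partial>\<mu>)"
    \<comment> \<open>If the square is not integrable, the Bochner integral \<open>q\<close> is 0 by
      default and the bound is trivial.\<close>
    proof (cases "integrable \<mu> (\<lambda>x. (h x)\<^sup>2)")
      case True
      then show ?thesis by (simp add: q_def nn_integral_eq_integral)
    qed (simp add: q_def not_integrable_integral_eq)
  qed (simp add: q_def)
  have "L2_norm \<mu> h = sqrt q" by (simp add: L2_norm_def q_def)
  also have "\<dots> \<le> 1 / (2 * b) * q + b / 2"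
    using sum_squares_bound[of "sqrt q" b] assms q(1) by (simp add: field_simps power2_eq_square)
  finally have "ennreal (L2_norm \<mu> h) \<le> ennreal (1 / (2 * b) * q + b / 2)"
    by (rule ennreal_leI)
  also have "\<dots> = ennreal (1 / (2 * b)) * ennreal q + ennreal (b / 2)"
    using assms q(1) by (simp add: ennreal_mult[symmetric])
  also have "\<dots> \<le> ennreal (1 / (2 * b)) * (\<integral>\<^sup>+x. ennreal ((h x)\<^sup>2) \<partial>\<mu>) + ennreal (b / 2)"
    using q(2) by (intro add_right_mono mult_left_mono) auto
  finally show ?thesis .
qed

section \<open>Consequences of the selection rule for a fixed split\<close>

context
  fixes N k M L :: nat and s :: "nat \<Rightarrow> nat"
    and nb :: "(nat \<Rightarrow> nat) \<Rightarrow> (nat \<Rightarrow> 'a::{metric_space, second_countable_topology}) \<Rightarrow> 'a \<Rightarrow> nat \<Rightarrow> nat set" and sel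
  assumes rule: "selection_rule N k M L nb sel" and s: "s \<in> equal_splits N M"
begin

lemma selection_rule_measurable:
  "m < M \<Longrightarrow> i < N \<Longrightarrow> {p \<in> space ((\<Pi>\<^sub>M i\<in>{..<N}. borel) \<Otimes>\<^sub>M borel). i \<in> nb s (fst p) (snd p) m}
     \<in> sets ((\<Pi>\<^sub>M i\<in>{..<N}. borel) \<Otimes>\<^sub>M borel)"
  "m < M \<Longrightarrow> {p \<in> space ((\<Pi>\<^sub>M i\<in>{..<N}. borel) \<Otimes>\<^sub>M borel). m \<in> sel s (fst p) (snd p)}
     \<in> sets ((\<Pi>\<^sub>M i\<in>{..<N}. borel) \<Otimes>\<^sub>M borel)"
  using rule s unfolding selection_rule_def by (simp_all add: space_pair_measure space_PiM)

lemma selection_rule_measurable_section: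
  shows "m < M \<Longrightarrow> i < N \<Longrightarrow> {X \<in> space (\<Pi>\<^sub>M i\<in>{..<N}. borel). i \<in> nb s X x m} \<in> sets (\<Pi>\<^sub>M i\<in>{..<N}. borel)"
    and "m < M \<Longrightarrow> {X \<in> space (\<Pi>\<^sub>M i\<in>{..<N}. borel). m \<in> sel s X x} \<in> sets (\<Pi>\<^sub>M i\<in>{..<N}. borel)"
proof -
  let ?Q = "\<Pi>\<^sub>M i\<in>{..<N}. (borel :: 'a measure)"
  have slice: "(\<lambda>X. (X, x)) -` {p \<in> space (?Q \<Otimes>\<^sub>M borel). R (fst p) (snd p)} \<inter> space ?Q = {X \<in> space ?Q. R X x}" for R
    by (auto simp: space_pair_measure)
  have meas: "(\<lambda>X. (X, x)) \<in> measurable ?Q (?Q \<Otimes>\<^sub>M borel)"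
    by (rule measurable_Pair2') simp
  show "{X \<in> space ?Q. i \<in> nb s X x m} \<in> sets ?Q" if "m < M" "i < N"
    using measurable_sets[OF meas selection_rule_measurable(1)[OF that]]
    unfolding slice[of "\<lambda>X x. i \<in> nb s X x m"] .
  show "{X \<in> space ?Q. m \<in> sel s X x} \<in> sets ?Q" if "m < M"
    using measurable_sets[OF meas selection_rule_measurable(2)[OF that]]
    unfolding slice[of "\<lambda>X x. m \<in> sel s X x"] .
qed

lemma selection_ruleD:
  assumes "X \<in> {..<N} \<rightarrow>\<^sub>E UNIV"
  shows "sel s X x \<subseteq> {..<M}" "card (sel s X x) = L"
    and "m < M \<Longrightarrow> k_smallest k (block N s m) (\<lambda>i. dist x (X i)) (nb s X x m)"
    and "m < M \<Longrightarrow> nb s X x m \<subseteq> block N s m" "m < M \<Longrightarrow> card (nb s X x m) = k"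
proof -
  have *: "\<forall>m<M. k_smallest k (block N s m) (\<lambda>i. dist x (X i)) (nb s X x m)"
    "k_smallest L {..<M} (\<lambda>m. nn_distance (k + 1) (block N s m) X x) (sel s X x)"
    using rule s assms unfolding selection_rule_def by blast+
  show "sel s X x \<subseteq> {..<M}" "card (sel s X x) = L"
    using *(2) unfolding k_smallest_def by blast+
  show nb: "k_smallest k (block N s m) (\<lambda>i. dist x (X i)) (nb s X x m)" if "m < M"
    using *(1) that by blast
  show "nb s X x m \<subseteq> block N s m" "card (nb s X x m) = k" if "m < M"
    using nb[OF that] unfolding k_smallest_def by blast+
qed

lemma sum_selected_rule:
  assumes "X \<in> {..<N} \<rightarrow>\<^sub>E UNIV"
  shows "(\<Sum>i\<in>selected N s (sel s X x) (nb s X x). f i) = (\<Sum>m\<in>sel s X x. \<Sum>i\<in>nb s X x m. f i)"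
proof (rule sum_selected)
  show "finite (sel s X x)"
    using selection_ruleD(1)[OF assms] by (rule finite_subset) simp
  fix m assume "m \<in> sel s X x"
  then have "m < M" using selection_ruleD(1)[OF assms, of x] by blast
  then show "nb s X x m \<subseteq> block N s m" by (rule selection_ruleD(4)[OF assms])
qed

lemma card_selected_rule:
  assumes "X \<in> {..<N} \<rightarrow>\<^sub>E UNIV"
  shows "card (selected N s (sel s X x) (nb s X x)) = k * L"
proof -
  have "card (selected N s (sel s X x) (nb s X x)) = (\<Sum>m\<in>sel s X x. card (nb s X x m))"
    unfolding card_eq_sum by (rule sum_selected_rule[OF assms])
  also have "\<dots> = (\<Sum>m\<in>sel s X x. k)"
    using selection_ruleD(1)[OF assms, of x] by (intro sum.cong refl selection_ruleD(5)[OF assms]) auto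
  finally show ?thesis
    by (simp add: selection_ruleD(2)[OF assms])
qed

lemma card_block: "m < M \<Longrightarrow> card (block N s m) = N div M"
  using s by (simp add: equal_splits_def block_def)

end

section \<open>Pointwise and integrated risk\<close>

context regression_model
begin

lemma covariates_PiE: "covariates I D \<in> I \<rightarrow>\<^sub>E UNIV"
  by (simp add: covariates_def)

text \<open>The blocks are disjoint and each selected one contributes exactly \<open>k\<close>
  labels, so the average of averages is a single average with equal weights over
  \<open>k * L\<close> distinct sample points.\<close>

lemma selective_knn_eq:
  assumes "selection_rule N k M L nb sel" "s \<in> equal_splits N M"
  defines "X \<equiv> covariates {..<N}"
  shows "selective_knn N k L nb sel (s, D) x =
    (\<Sum>i\<in>selected N s (sel s (X D) x) (nb s (X D) x). snd (D i)) / real (k * L)"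
proof -
  have "X D \<in> {..<N} \<rightarrow>\<^sub>E UNIV" unfolding X_def by (rule covariates_PiE)
  then have "(\<Sum>i\<in>selected N s (sel s (X D) x) (nb s (X D) x). snd (D i)) =
      (\<Sum>m\<in>sel s (X D) x. \<Sum>i\<in>nb s (X D) x m. snd (D i))"
    by (rule sum_selected_rule[OF assms(1,2)])
  then show ?thesis
    by (simp add: selective_knn_def Let_def X_def covariates_def sum_divide_distrib[symmetric])
qed

text \<open>Joint measurability in sample and query point is what the later exchange of integrals
  needs. The random sum lemma is used twice, for the selected blocks and for the neighbors inside
  each block.\<close>

lemma measurable_selective_knn:
  assumes rule: "selection_rule N k M L nb sel" "s \<in> equal_splits N M"
  shows "(\<lambda>(D, x). selective_knn N k L nb sel (s, D) x)
    \<in> borel_measurable (PiM {..<N} (\<lambda>_. P) \<Otimes>\<^sub>M borel)"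
proof -
  let ?Q = "PiM {..<N} (\<lambda>_. P) \<Otimes>\<^sub>M (borel :: 'a measure)"
  define pt where "pt p = (covariates {..<N} (fst p), snd p)" for p :: "(nat \<Rightarrow> 'a \<times> real) \<times> 'a"
  have pt: "pt \<in> measurable ?Q ((\<Pi>\<^sub>M i\<in>{..<N}. borel) \<Otimes>\<^sub>M borel)"
    unfolding pt_def[abs_def] by measurable
  note E = covariates_PiE[of "{..<N}"]
  have nb: "{p \<in> space ?Q. i \<in> nb s (covariates {..<N} (fst p)) (snd p) m} \<in> sets ?Q" if "m < M" "i < N" for m i
  proof -
    have "pt -` {p \<in> space ((\<Pi>\<^sub>M i\<in>{..<N}. borel) \<Otimes>\<^sub>M borel). i \<in> nb s (fst p) (snd p) m} \<inter> space ?Q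
        = {p \<in> space ?Q. i \<in> nb s (covariates {..<N} (fst p)) (snd p) m}"
      using measurable_space[OF pt] by (auto simp: pt_def)
    then show ?thesis
      using measurable_sets[OF pt selection_rule_measurable(1)[OF rule that]] by simp
  qed
  have sel: "{p \<in> space ?Q. m \<in> sel s (covariates {..<N} (fst p)) (snd p)} \<in> sets ?Q" if "m < M" for m
  proof -
    have "pt -` {p \<in> space ((\<Pi>\<^sub>M i\<in>{..<N}. borel) \<Otimes>\<^sub>M borel). m \<in> sel s (fst p) (snd p)} \<inter> space ?Q
        = {p \<in> space ?Q. m \<in> sel s (covariates {..<N} (fst p)) (snd p)}"
      using measurable_space[OF pt] by (auto simp: pt_def)
    then show ?thesis
      using measurable_sets[OF pt selection_rule_measurable(2)[OF rule that]] by simp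
  qed
  have "(\<lambda>p. \<Sum>m\<in>sel s (covariates {..<N} (fst p)) (snd p).
      (\<Sum>i\<in>nb s (covariates {..<N} (fst p)) (snd p) m. snd (fst p i)) / real k) \<in> borel_measurable ?Q"
  proof (rule borel_measurable_random_sum[of "{..<M}"])
    fix m assume m: "m \<in> {..<M}"
    then have "(\<lambda>p. \<Sum>i\<in>nb s (covariates {..<N} (fst p)) (snd p) m. snd (fst p i)) \<in> borel_measurable ?Q"
    proof (intro borel_measurable_random_sum[of "{..<N}"] nb)
      show "nb s (covariates {..<N} (fst p)) (snd p) m \<subseteq> {..<N}" for p
        using selection_ruleD(4)[OF rule E, of m] m by (auto simp: block_def)
    qed (use m in \<open>auto simp: sets_P intro!: measurable_compose[OF _ measurable_snd]\<close>)
    then show "(\<lambda>p. (\<Sum>i\<in>nb s (covariates {..<N} (fst p)) (snd p) m. snd (fst p i)) / real k) \<in> borel_measurable ?Q"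
      by simp
  qed (use selection_ruleD(1)[OF rule E] sel in auto)
  then show ?thesis
    by (simp add: selective_knn_def Let_def case_prod_beta covariates_def)
qed

text \<open>The noise sum has second moment at most \<open>V * k * L\<close> and is divided by the
  square of \<open>k * L\<close>. For the bias, each block contributes at most \<open>k\<close>
  times the moment bound \<open>\<tau>\<close>; summing over \<open>M\<close> blocks and dividing by
  \<open>k * L\<close> leaves the ratio \<open>M / L\<close>.\<close>

lemma pointwise_risk_le:
  assumes rule: "selection_rule N k M L nb sel" and s: "s \<in> equal_splits N M"
    and adm: "admissible_split N k M" and L: "1 \<le> L"
    and hom: "homogeneous (marginal P) C d" "x \<in> support (marginal P)" and pos: "0 < C" "0 < d" "0 < \<alpha>"
    and hoelder: "hoelder_continuous \<alpha> A \<eta>"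
  shows "(\<integral>\<^sup>+D. ennreal ((selective_knn N k L nb sel (s, D) x - \<eta> x)\<^sup>2) \<partial>PiM {..<N} (\<lambda>_. P))
    \<le> ennreal (2 * V / real (k * L) + 2 * A\<^sup>2 * (real M / real L) *
        ((real k / (real (N div M) * C)) powr (2 * \<alpha> / d) * tail_series (2 * \<alpha> / d)))"
proof -
  let ?Q = "PiM {..<N} (\<lambda>_. P)"
  define \<tau> where "\<tau> = (real k / (real (N div M) * C)) powr (2 * \<alpha> / d) * tail_series (2 * \<alpha> / d)"
  have \<tau>: "0 \<le> \<tau>" by (simp add: \<tau>_def tail_series_nonneg)
  define K where "K = real (k * L)"
  have k: "1 \<le> k" "k + 1 \<le> N div M" using adm by (auto simp: admissible_split_def)
  have K: "0 < K" using k L by (simp add: K_def)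
  define S where "S D = selected N s (sel s (covariates {..<N} D) x) (nb s (covariates {..<N} D) x)" for D
  \<comment> \<open>Selection as 0/1 weights on all sample indices: functions of the covariates
    only, as the orthogonality argument demands.\<close>
  define w where "w i X = (of_bool (i \<in> selected N s (sel s X x) (nb s X x)) :: real)" for i X
  define r where "r D i = dist x (fst (D i))" for D :: "nat \<Rightarrow> 'a \<times> real" and i
  note E = covariates_PiE[of "{..<N}"]
  have S_sub: "S D \<subseteq> {..<N}" for D by (auto simp: S_def selected_def)
  then have finS: "finite (S D)" for D by (rule finite_subset) simp
  have cardS: "card (S D) = k * L" for D
    unfolding S_def by (rule card_selected_rule[OF rule s E])
  have neS: "S D \<noteq> {}" for D using cardS[of D] k L by auto
  have w_sum: "(\<Sum>i<N. w i (covariates {..<N} D) * f i) = (\<Sum>i\<in>S D. f i)" for f :: "nat \<Rightarrow> real" and D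
  proof -
    have "(\<Sum>i<N. w i (covariates {..<N} D) * f i) = (\<Sum>i<N. if i \<in> S D then f i else 0)"
      by (intro sum.cong) (auto simp: w_def S_def)
    then show ?thesis
      using S_sub[of D] by (simp add: sum.inter_restrict[symmetric] Int_absorb1)
  qed
  have w_meas: "w i \<in> borel_measurable (PiM {..<N} (\<lambda>_. borel))" if "i < N" for i
  proof -
    have "s i < M" using s that by (auto simp: equal_splits_def PiE_def Pi_def)
    then have "{X \<in> space (PiM {..<N} (\<lambda>_. borel)). s i \<in> sel s X x} \<inter>
        {X \<in> space (PiM {..<N} (\<lambda>_. borel)). i \<in> nb s X x (s i)} \<in> sets (PiM {..<N} (\<lambda>_. borel))"
      using that by (intro sets.Int selection_rule_measurable_section[OF rule s])
    also have "{X \<in> space (PiM {..<N} (\<lambda>_. borel)). s i \<in> sel s X x} \<inter>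
        {X \<in> space (PiM {..<N} (\<lambda>_. borel)). i \<in> nb s X x (s i)} =
        {X \<in> space (PiM {..<N} (\<lambda>_. borel)). i \<in> selected N s (sel s X x) (nb s X x)}"
      using that by (auto simp: selected_def)
    finally show ?thesis
      unfolding w_def of_bool_def by (intro measurable_If) auto
  qed
  have nb_meas: "(\<lambda>D. \<Sum>i\<in>nb s (covariates {..<N} D) x m. ennreal (r D i powr (2 * \<alpha>))) \<in> borel_measurable ?Q"
    if "m < M" for m
  proof (rule borel_measurable_random_sum[of "{..<N}"])
    show "nb s (covariates {..<N} D) x m \<subseteq> {..<N}" for D
      using selection_ruleD(4)[OF rule s E that] by (auto simp: block_def)
    fix i assume i: "i \<in> {..<N}"
    have "covariates {..<N} -` {X \<in> space (PiM {..<N} (\<lambda>_. borel)). i \<in> nb s X x m} \<inter> space ?Q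
        = {D \<in> space ?Q. i \<in> nb s (covariates {..<N} D) x m}"
      using measurable_space[OF measurable_covariates] by auto
    then show "{D \<in> space ?Q. i \<in> nb s (covariates {..<N} D) x m} \<in> sets ?Q"
      using measurable_sets[OF measurable_covariates selection_rule_measurable_section(1)[OF rule s that], of i x] i
      by simp
    show "(\<lambda>D. ennreal (r D i powr (2 * \<alpha>))) \<in> borel_measurable ?Q"
      using i unfolding r_def by measurable
  qed simp
  have [measurable]: "(\<lambda>D. \<Sum>i<N. w i (covariates {..<N} D) * noise (D i)) \<in> borel_measurable ?Q"
    using w_meas by (intro borel_measurable_sum borel_measurable_times measurable_compose[OF measurable_covariates]) auto
  have error: "ennreal ((selective_knn N k L nb sel (s, D) x - \<eta> x)\<^sup>2) \<le>
      ennreal (2 / K\<^sup>2) * ennreal ((\<Sum>i<N. w i (covariates {..<N} D) * noise (D i))\<^sup>2) +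
      ennreal (2 * A\<^sup>2 / K) * (\<Sum>m<M. \<Sum>i\<in>nb s (covariates {..<N} D) x m. ennreal (r D i powr (2 * \<alpha>)))" for D
  proof -
    have "\<bar>\<eta> (fst (D i)) - \<eta> x\<bar> \<le> A * r D i powr \<alpha>" for i
      using hoelder unfolding hoelder_continuous_def r_def by (metis dist_commute)
    then have "((\<Sum>i\<in>S D. snd (D i)) / real (card (S D)) - \<eta> x)\<^sup>2 \<le>
        2 / (real (card (S D)))\<^sup>2 * (\<Sum>i\<in>S D. snd (D i) - \<eta> (fst (D i)))\<^sup>2 +
        2 * A\<^sup>2 / real (card (S D)) * (\<Sum>i\<in>S D. r D i powr (2 * \<alpha>))"
      by (intro average_error_square_le finS neS)
    then have "(selective_knn N k L nb sel (s, D) x - \<eta> x)\<^sup>2 \<le>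
        2 / K\<^sup>2 * (\<Sum>i\<in>S D. noise (D i))\<^sup>2 + 2 * A\<^sup>2 / K * (\<Sum>i\<in>S D. r D i powr (2 * \<alpha>))"
      unfolding cardS unfolding noise_def K_def selective_knn_eq[OF rule s] S_def .
    then have "ennreal ((selective_knn N k L nb sel (s, D) x - \<eta> x)\<^sup>2) \<le>
        ennreal (2 / K\<^sup>2) * ennreal ((\<Sum>i\<in>S D. noise (D i))\<^sup>2) +
        ennreal (2 * A\<^sup>2 / K) * ennreal (\<Sum>i\<in>S D. r D i powr (2 * \<alpha>))"
      using K by (simp add: ennreal_mult[symmetric] ennreal_plus[symmetric] sum_nonneg del: ennreal_plus)
    also have "ennreal (\<Sum>i\<in>S D. r D i powr (2 * \<alpha>)) =
        (\<Sum>m\<in>sel s (covariates {..<N} D) x. \<Sum>i\<in>nb s (covariates {..<N} D) x m. ennreal (r D i powr (2 * \<alpha>)))"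
      unfolding S_def sum_selected_rule[OF rule s E, symmetric] by (rule sum_ennreal[symmetric]) simp
    \<comment> \<open>Being selected changes the law of the distances in a block. Enlarging the
      nonnegative sum to all blocks removes this dependence.\<close>
    also have "\<dots> \<le> (\<Sum>m<M. \<Sum>i\<in>nb s (covariates {..<N} D) x m. ennreal (r D i powr (2 * \<alpha>)))"
      using selection_ruleD(1)[OF rule s E] by (intro sum_mono2) auto
    finally show ?thesis
      by (simp add: w_sum mult_left_mono add_left_mono)
  qed
  have "(\<integral>\<^sup>+D. ennreal ((selective_knn N k L nb sel (s, D) x - \<eta> x)\<^sup>2) \<partial>?Q) \<le>
      (\<integral>\<^sup>+D. ennreal (2 / K\<^sup>2) * ennreal ((\<Sum>i<N. w i (covariates {..<N} D) * noise (D i))\<^sup>2) +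
      ennreal (2 * A\<^sup>2 / K) * (\<Sum>m<M. \<Sum>i\<in>nb s (covariates {..<N} D) x m. ennreal (r D i powr (2 * \<alpha>))) \<partial>?Q)"
    by (intro nn_integral_mono error)
  also have "\<dots> = ennreal (2 / K\<^sup>2) * (\<integral>\<^sup>+D. ennreal ((\<Sum>i<N. w i (covariates {..<N} D) * noise (D i))\<^sup>2) \<partial>?Q) +
      ennreal (2 * A\<^sup>2 / K) * (\<Sum>m<M. \<integral>\<^sup>+D. (\<Sum>i\<in>nb s (covariates {..<N} D) x m. ennreal (r D i powr (2 * \<alpha>))) \<partial>?Q)"
  proof -
    have meas: "(\<lambda>D. \<Sum>i\<in>nb s (covariates {..<N} D) x m. ennreal (r D i powr (2 * \<alpha>))) \<in> borel_measurable ?Q"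
      if "m \<in> {..<M}" for m
      using that by (intro nb_meas) simp
    have [measurable]: "(\<lambda>D. \<Sum>m<M. \<Sum>i\<in>nb s (covariates {..<N} D) x m. ennreal (r D i powr (2 * \<alpha>))) \<in> borel_measurable ?Q"
      by (intro borel_measurable_sum meas)
    have "(\<integral>\<^sup>+D. (\<Sum>m<M. \<Sum>i\<in>nb s (covariates {..<N} D) x m. ennreal (r D i powr (2 * \<alpha>))) \<partial>?Q) =
        (\<Sum>m<M. \<integral>\<^sup>+D. (\<Sum>i\<in>nb s (covariates {..<N} D) x m. ennreal (r D i powr (2 * \<alpha>))) \<partial>?Q)"
      by (rule nn_integral_sum[OF meas])
    then show ?thesis
      by (simp add: nn_integral_add nn_integral_cmult del: sum_ennreal)
  qed
  also have "\<dots> \<le> ennreal (2 / K\<^sup>2) * (ennreal V * ennreal K) +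
      ennreal (2 * A\<^sup>2 / K) * (\<Sum>m<M. ennreal (real k * \<tau>))"
  proof (intro add_mono mult_left_mono sum_mono)
    \<comment> \<open>The weights equal their squares, so the sum of squares is the constant number
      of selected points.\<close>
    have w_square: "(\<Sum>i<N. (w i (covariates {..<N} D))\<^sup>2) = K" for D
    proof -
      have "(\<Sum>i<N. (w i (covariates {..<N} D))\<^sup>2) = (\<Sum>i<N. w i (covariates {..<N} D) * 1)"
        by (intro sum.cong) (auto simp: w_def)
      then show ?thesis unfolding w_sum by (simp add: cardS K_def)
    qed
    have "(\<integral>\<^sup>+D. ennreal ((\<Sum>i<N. w i (covariates {..<N} D) * noise (D i))\<^sup>2) \<partial>?Q) \<le>
        ennreal V * (\<integral>\<^sup>+D. ennreal (\<Sum>i<N. (w i (covariates {..<N} D))\<^sup>2) \<partial>?Q)"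
    proof (rule weighted_noise_sum_second_moment)
      show "w i \<in> borel_measurable (PiM {..<N} (\<lambda>_. borel))" if "i \<in> {..<N}" for i
        using that by (intro w_meas) simp
      show "\<bar>w i X\<bar> \<le> 1" for i X by (simp add: w_def)
    qed simp
    also have "(\<integral>\<^sup>+D. ennreal (\<Sum>i<N. (w i (covariates {..<N} D))\<^sup>2) \<partial>?Q) = ennreal K"
      unfolding w_square using prob_space.emeasure_space_1[OF prob_space_PiM_P[of "{..<N}"]] by simp
    finally show "(\<integral>\<^sup>+D. ennreal ((\<Sum>i<N. w i (covariates {..<N} D) * noise (D i))\<^sup>2) \<partial>?Q) \<le> ennreal V * ennreal K" .
  next
    fix m assume "m \<in> {..<M}"
    then have m: "m < M" by simp
    have "k_smallest k (block N s m) (\<lambda>i. dist x (fst (D i))) (nb s (covariates {..<N} D) x m)" for D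
      by (rule k_smallest_cong[OF selection_ruleD(3)[OF rule s E m]]) (simp add: covariates_def block_def)
    then have "(\<integral>\<^sup>+D. (\<Sum>i\<in>nb s (covariates {..<N} D) x m. ennreal (dist x (fst (D i)) powr (d * (2 * \<alpha> / d)))) \<partial>?Q)
        \<le> ennreal (real k * ((real k / (real (card (block N s m)) * C)) powr (2 * \<alpha> / d) * tail_series (2 * \<alpha> / d)))"
      using hom pos k card_block[OF rule s m]
      by (intro neighbor_distance_moment) (auto simp: block_def)
    then show "(\<integral>\<^sup>+D. (\<Sum>i\<in>nb s (covariates {..<N} D) x m. ennreal (r D i powr (2 * \<alpha>))) \<partial>?Q) \<le> ennreal (real k * \<tau>)"
      using pos card_block[OF rule s m] by (simp add: r_def \<tau>_def)
  qed auto
  also have "\<dots> = ennreal (2 / K\<^sup>2 * (V * K) + 2 * A\<^sup>2 / K * (real M * (real k * \<tau>)))"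
    using K V_nonneg \<tau> by (simp add: ennreal_mult[symmetric] ennreal_of_nat_eq_real_of_nat)
  also have "2 / K\<^sup>2 * (V * K) + 2 * A\<^sup>2 / K * (real M * (real k * \<tau>)) =
      2 * V / real (k * L) + 2 * A\<^sup>2 * (real M / real L) * \<tau>"
    using K k L unfolding K_def by (simp add: field_simps power2_eq_square)
  finally show ?thesis unfolding \<tau>_def .
qed

lemma prob_space_marginal: "prob_space (marginal P)"
  unfolding marginal_def by (rule prob_space_distr) measurable

lemma sets_marginal: "sets (marginal P) = sets borel"
  by (simp add: marginal_def)

text \<open>After linearizing the root with the free parameter \<open>b\<close>, the integrals over
  sample and query point are exchanged and the pointwise bound is used at almost every query point.
  The bound does not depend on the split, so averaging over splits preserves it.\<close>

lemma selective_knn_risk_le: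
  assumes rule: "selection_rule N k M L nb sel" and adm: "admissible_split N k M" and L: "1 \<le> L"
    and hom: "homogeneous (marginal P) C d" and pos: "0 < C" "0 < d" "0 < \<alpha>"
    and hoelder: "hoelder_continuous \<alpha> A \<eta>" and b: "0 < b"
  defines "Q \<equiv> 2 * V / real (k * L) + 2 * A\<^sup>2 * (real M / real L) *
        ((real k / (real (N div M) * C)) powr (2 * \<alpha> / d) * tail_series (2 * \<alpha> / d))"
  shows "selective_knn_risk P \<eta> N k M L nb sel \<le> Q / (2 * b) + b / 2"
proof -
  let ?\<mu> = "marginal P" and ?U = "uniform_count_measure (equal_splits N M)" and ?D = "PiM {..<N} (\<lambda>_. P)"
  define f where "f \<omega> x = selective_knn N k L nb sel \<omega> x - \<eta> x" for \<omega> x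
  define G where "G \<omega> = (\<integral>\<^sup>+x. ennreal ((f \<omega> x)\<^sup>2) \<partial>?\<mu>)" for \<omega>
  interpret \<mu>: prob_space ?\<mu> by (rule prob_space_marginal)
  interpret D: prob_space ?D by (rule prob_space_PiM_P)
  interpret D\<mu>: pair_sigma_finite ?D ?\<mu> ..
  note [measurable_cong] = sets_marginal
  have Q: "0 \<le> Q"
    using V_nonneg pos by (auto simp: Q_def tail_series_nonneg)
  have fin: "finite (equal_splits N M)"
    by (rule finite_subset[of _ "{..<N} \<rightarrow>\<^sub>E {..<M}"]) (auto simp: equal_splits_def intro: finite_PiE)
  have f_meas: "(\<lambda>(D, x). f (s, D) x) \<in> borel_measurable (?D \<Otimes>\<^sub>M ?\<mu>)" if "s \<in> equal_splits N M" for s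
  proof -
    have [measurable]: "(\<lambda>(D, x). selective_knn N k L nb sel (s, D) x) \<in> borel_measurable (?D \<Otimes>\<^sub>M ?\<mu>)"
      using measurable_selective_knn[OF rule that]
      by (simp cong: measurable_cong_sets add: sets_pair_measure_cong[OF refl sets_marginal])
    show ?thesis unfolding f_def by measurable
  qed
  then have f2_meas: "(\<lambda>(D, x). ennreal ((f (s, D) x)\<^sup>2)) \<in> borel_measurable (?D \<Otimes>\<^sub>M ?\<mu>)" if "s \<in> equal_splits N M" for s
    using that by (simp add: case_prod_beta) measurable
  have G_meas_s: "(\<lambda>D. G (s, D)) \<in> borel_measurable ?D" if "s \<in> equal_splits N M" for s
    unfolding G_def using f2_meas[OF that] by (rule \<mu>.borel_measurable_nn_integral)
  \<comment> \<open>There are finitely many splits, so measurability for each fixed split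
    suffices.\<close>
  have G_meas: "G \<in> borel_measurable (?U \<Otimes>\<^sub>M ?D)"
  proof -
    have "G \<in> borel_measurable (count_space (equal_splits N M) \<Otimes>\<^sub>M ?D)"
      using G_meas_s fin by (intro measurable_pair_measure_countable1) (auto intro: countable_finite)
    moreover have "sets (count_space (equal_splits N M) \<Otimes>\<^sub>M ?D) = sets (?U \<Otimes>\<^sub>M ?D)"
      by (intro sets_pair_measure_cong) (simp_all add: sets_uniform_count_measure)
    ultimately show ?thesis
      using measurable_cong_sets[OF _ refl] by blast
  qed
  have G_le: "(\<integral>\<^sup>+D. G (s, D) \<partial>?D) \<le> ennreal Q" if s: "s \<in> equal_splits N M" for s
  proof -
    have "(\<integral>\<^sup>+D. G (s, D) \<partial>?D) = (\<integral>\<^sup>+x. \<integral>\<^sup>+D. ennreal ((f (s, D) x)\<^sup>2) \<partial>?D \<partial>?\<mu>)"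
      unfolding G_def by (rule D\<mu>.Fubini'[OF f2_meas[OF s], symmetric])
    also have "\<dots> \<le> (\<integral>\<^sup>+x. ennreal Q \<partial>?\<mu>)"
    proof (rule nn_integral_mono_AE)
      show "AE x in ?\<mu>. (\<integral>\<^sup>+D. ennreal ((f (s, D) x)\<^sup>2) \<partial>?D) \<le> ennreal Q"
        using AE_support[OF \<mu>.finite_measure_axioms sets_marginal]
      proof eventually_elim
        case (elim x)
        show ?case
          unfolding f_def Q_def by (rule pointwise_risk_le[OF rule s adm L hom elim pos hoelder])
      qed
    qed
    also have "\<dots> = ennreal Q" by (simp add: \<mu>.emeasure_space_1)
    finally show ?thesis .
  qed
  have "(\<integral>\<^sup>+\<omega>. ennreal (L2_norm ?\<mu> (f \<omega>)) \<partial>(?U \<Otimes>\<^sub>M ?D))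
      \<le> (\<integral>\<^sup>+\<omega>. ennreal (1 / (2 * b)) * G \<omega> + ennreal (b / 2) \<partial>(?U \<Otimes>\<^sub>M ?D))"
    unfolding G_def by (intro nn_integral_mono L2_norm_le b)
  also have "\<dots> = (\<integral>\<^sup>+s. \<integral>\<^sup>+D. ennreal (1 / (2 * b)) * G (s, D) + ennreal (b / 2) \<partial>?D \<partial>?U)"
    by (intro D.nn_integral_fst[symmetric] borel_measurable_add borel_measurable_times_ennreal
        borel_measurable_const G_meas)
  also have "\<dots> \<le> (\<integral>\<^sup>+s. ennreal (Q / (2 * b) + b / 2) \<partial>?U)"
  proof (rule nn_integral_mono)
    fix s assume "s \<in> space ?U"
    then have s: "s \<in> equal_splits N M" by (simp add: space_uniform_count_measure)
    have "(\<integral>\<^sup>+D. ennreal (1 / (2 * b)) * G (s, D) + ennreal (b / 2) \<partial>?D) =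
        ennreal (1 / (2 * b)) * (\<integral>\<^sup>+D. G (s, D) \<partial>?D) + ennreal (b / 2)"
      using G_meas_s[OF s] by (simp add: nn_integral_add nn_integral_cmult D.emeasure_space_1)
    also have "\<dots> \<le> ennreal (1 / (2 * b)) * ennreal Q + ennreal (b / 2)"
      by (intro add_right_mono mult_left_mono G_le s) simp
    also have "\<dots> = ennreal (Q / (2 * b) + b / 2)"
      using b Q by (simp add: ennreal_mult[symmetric])
    finally show "(\<integral>\<^sup>+D. ennreal (1 / (2 * b)) * G (s, D) + ennreal (b / 2) \<partial>?D) \<le> ennreal (Q / (2 * b) + b / 2)" .
  qed
  also have "\<dots> \<le> ennreal (Q / (2 * b) + b / 2) * 1"
  proof -
    \<comment> \<open>An inequality is enough, and it also covers an empty set of splits, where the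
      measure vanishes.\<close>
    have "emeasure ?U (space ?U) \<le> 1"
      using fin by (cases "equal_splits N M = {}")
        (simp_all add: emeasure_uniform_count_measure space_uniform_count_measure flip: ennreal_1)
    then show ?thesis unfolding nn_integral_const by (rule mult_left_mono) simp
  qed
  \<comment> \<open>A bound on the nonnegative integral passes to the Bochner integral, which is 0
    by default when the integrand is not integrable.\<close>
  finally show ?thesis
    using b Q unfolding selective_knn_risk_def split_sample_def f_def
    by (intro integral_real_bounded) simp_all
qed

end

section \<open>From conditional moments to the rate of convergence\<close>

lemma selective_knn_risk_nonneg: "0 \<le> selective_knn_risk P \<eta> N k M L nb sel"
  unfolding selective_knn_risk_def L2_norm_def by (intro Bochner_Integration.integral_nonneg) auto

text \<open>Functions of the covariate are measurable for \<open>covariate_algebra P\<close>, so the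
  defining property of conditional expectation lets them be used as test functions; then the given
  versions are substituted almost everywhere.\<close>

lemma regression_model_of_conditional_moments:
  fixes P :: "('a::{metric_space, second_countable_topology} \<times> real) measure"
  assumes P: "prob_space P" "sets P = sets (borel \<Otimes>\<^sub>M borel)"
    and reg: "regression_function P \<eta>" and var: "conditional_variance P \<eta> v"
    and V: "\<And>x. v x \<le> V"
  shows "regression_model P \<eta> V"
proof -
  interpret prob_space P by fact
  have \<eta> [measurable]: "\<eta> \<in> borel_measurable borel" and int: "integrable P snd"
    and cond: "AE z in P. real_cond_exp P (covariate_algebra P) snd z = \<eta> (fst z)"
    using reg by (auto simp: regression_function_def)
  have v: "v \<in> borel_measurable borel" "\<And>x. 0 \<le> v x"
    and cond_v: "AE z in P. nn_cond_exp P (covariate_algebra P)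
       (\<lambda>z. ennreal ((snd z - \<eta> (fst z))\<^sup>2)) z = ennreal (v (fst z))"
    using var by (auto simp: conditional_variance_def)
  note [measurable_cong] = P(2)
  have fst [measurable]: "fst \<in> measurable P borel" by measurable
  interpret sigma_finite_subalgebra P "covariate_algebra P"
  proof (rule finite_measure_subalgebra_is_sigma_finite, unfold_locales)
    show "subalgebra P (covariate_algebra P)"
      using measurable_sets[OF fst] unfolding subalgebra_def covariate_algebra_def
      by (auto simp: sets_vimage_algebra2)
  qed
  have comp: "(\<lambda>z. h (fst z)) \<in> borel_measurable (covariate_algebra P)" if "h \<in> borel_measurable borel"
    for h :: "'a \<Rightarrow> 'c::topological_space"
    using that unfolding covariate_algebra_def
    by (intro measurable_compose[OF measurable_vimage_algebra1]) auto
  show ?thesis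
  proof
    show "sets P = sets (borel \<Otimes>\<^sub>M borel)" "\<eta> \<in> borel_measurable borel" by fact+
    show "0 \<le> V" using v(2) V by (rule order.trans)
  next
    fix h :: "'a \<Rightarrow> real" assume h [measurable]: "h \<in> borel_measurable borel" and bd: "\<And>x. \<bar>h x\<bar> \<le> 1"
    \<comment> \<open>Boundedness of the test function transfers integrability from the label, as
      the signed conditional expectation requires.\<close>
    have 1: "integrable P (\<lambda>z. h (fst z) * snd z)"
    proof (rule Bochner_Integration.integrable_bound[OF int])
      show "AE z in P. norm (h (fst z) * snd z) \<le> norm (snd z)"
        using mult_right_mono[OF bd abs_ge_zero] by (auto simp: abs_mult)
    qed measurable
    note ce = real_cond_exp_intg[OF 1 comp[OF h]]
    have 2: "AE z in P. h (fst z) * real_cond_exp P (covariate_algebra P) snd z = h (fst z) * \<eta> (fst z)"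
      using cond by eventually_elim simp
    have "integrable P (\<lambda>z. h (fst z) * \<eta> (fst z))"
      by (rule integrable_cong_AE_imp[OF ce(1) _ 2]) measurable
    moreover have "(\<integral>z. h (fst z) * real_cond_exp P (covariate_algebra P) snd z \<partial>P) =
        (\<integral>z. h (fst z) * \<eta> (fst z) \<partial>P)"
      using 2 by (intro integral_cong_AE) simp_all
    with ce(2) have "(\<integral>z. h (fst z) * \<eta> (fst z) \<partial>P) = (\<integral>z. h (fst z) * snd z \<partial>P)"
      by simp
    ultimately show "(\<integral>z. h (fst z) * (snd z - \<eta> (fst z)) \<partial>P) = 0"
      using 1 by (simp add: right_diff_distrib)
  next
    fix h :: "'a \<Rightarrow> ennreal" assume h [measurable]: "h \<in> borel_measurable borel"
    have "(\<integral>\<^sup>+z. h (fst z) * ennreal ((snd z - \<eta> (fst z))\<^sup>2) \<partial>P) =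
        (\<integral>\<^sup>+z. h (fst z) * nn_cond_exp P (covariate_algebra P) (\<lambda>z. ennreal ((snd z - \<eta> (fst z))\<^sup>2)) z \<partial>P)"
      by (rule nn_cond_exp_intg[symmetric, OF comp[OF h]]) measurable
    also have "\<dots> \<le> (\<integral>\<^sup>+z. h (fst z) * ennreal V \<partial>P)"
      using cond_v
      by (intro nn_integral_mono_AE) (auto intro!: mult_left_mono ennreal_leI V elim!: eventually_mono)
    also have "\<dots> = ennreal V * (\<integral>\<^sup>+z. h (fst z) \<partial>P)"
      by (subst nn_integral_multc) (auto simp: mult.commute)
    finally show "(\<integral>\<^sup>+z. h (fst z) * ennreal ((snd z - \<eta> (fst z))\<^sup>2) \<partial>P) \<le> ennreal V * (\<integral>\<^sup>+z. h (fst z) \<partial>P)" .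
  qed
qed

theorem corollary9:
  fixes P :: "('a::{metric_space, second_countable_topology} \<times> real) measure"
    and \<eta> v :: "'a \<Rightarrow> real"
    and d C_d \<alpha> A :: real
  assumes "prob_space P" and "sets P = sets (borel \<Otimes>\<^sub>M borel)"
    and "regression_function P \<eta>"
    and "conditional_variance P \<eta> v"
    and "d > 0" and "doubling (marginal P) d"
    and "C_d > 0" and "homogeneous (marginal P) C_d d"
    and "0 < \<alpha>" and "\<alpha> \<le> 1" and "A > 0" and "hoelder_continuous \<alpha> A \<eta>"
    and "bdd_above (range (\<lambda>x. \<bar>\<eta> x\<bar>))"
    and "bdd_above (range v)"
    and "bounded (support (marginal P))"
  shows "\<exists>c\<in>{0<..<1}.
    \<forall>(S :: nat set) (k :: nat \<Rightarrow> nat) (M :: nat \<Rightarrow> nat) (L :: nat \<Rightarrow> nat) nb sel.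
      (\<forall>N\<in>S. admissible_split N (k N) (M N)
               \<and> L N = nat \<lceil>(1 - c) * real (M N)\<rceil>
               \<and> selection_rule N (k N) (M N) (L N) (nb N) (sel N)) \<longrightarrow>
      (\<lambda>N. real (k N * M N))
        \<in> \<Theta>[inf at_top (principal S)](\<lambda>N. real N powr (2 * \<alpha> / (2 * \<alpha> + d))) \<longrightarrow>
      (\<lambda>N. selective_knn_risk P \<eta> N (k N) (M N) (L N) (nb N) (sel N))
        \<in> O[inf at_top (principal S)](\<lambda>N. real N powr (- \<alpha> / (2 * \<alpha> + d)))"
proof (intro bexI[of _ "1 / 2"] allI impI)
  \<comment> \<open>With the witness \<open>1 / 2\<close>, at least half of the blocks are kept, so
    the variance and the bias each lose at most a factor 2.\<close>
  fix S :: "nat set" and k M L :: "nat \<Rightarrow> nat"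
    and nb :: "nat \<Rightarrow> (nat \<Rightarrow> nat) \<Rightarrow> (nat \<Rightarrow> 'a) \<Rightarrow> 'a \<Rightarrow> nat \<Rightarrow> nat set"
    and sel :: "nat \<Rightarrow> (nat \<Rightarrow> nat) \<Rightarrow> (nat \<Rightarrow> 'a) \<Rightarrow> 'a \<Rightarrow> nat set"
  assume H: "\<forall>N\<in>S. admissible_split N (k N) (M N) \<and> L N = nat \<lceil>(1 - 1 / 2) * real (M N)\<rceil>
      \<and> selection_rule N (k N) (M N) (L N) (nb N) (sel N)"
    and \<Theta>: "(\<lambda>N. real (k N * M N))
      \<in> \<Theta>[inf at_top (principal S)](\<lambda>N. real N powr (2 * \<alpha> / (2 * \<alpha> + d)))"
  let ?F = "inf at_top (principal S) :: nat filter"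
  obtain V where V: "\<And>x. v x \<le> V"
    using \<open>bdd_above (range v)\<close> by (auto simp: bdd_above_def)
  interpret regression_model P \<eta> V
    by (rule regression_model_of_conditional_moments[OF assms(1-4) V])
  note pos = \<open>C_d > 0\<close> \<open>d > 0\<close> \<open>0 < \<alpha>\<close>
  define \<gamma> where "\<gamma> = 2 * \<alpha> / (2 * \<alpha> + d)"
  define \<beta> where "\<beta> = 2 * \<alpha> / d"
  have "2 * \<alpha> + d > 0" using pos by simp
  \<comment> \<open>The balance behind the rate:
    \<open>\<gamma> - 1 = - d / (2 * \<alpha> + d)\<close>, so a squared bias of order
    \<open>(k * M / N) powr \<beta>\<close> and a variance of order \<open>1 / (k * M)\<close> both
    become \<open>N powr (- \<gamma>)\<close>.\<close>
  then have \<gamma>\<beta>: "(\<gamma> - 1) * \<beta> = - \<gamma>" and half: "- \<alpha> / (2 * \<alpha> + d) = - \<gamma> / 2"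
    using pos by (simp_all add: \<gamma>_def \<beta>_def field_simps)
  have \<beta>: "0 < \<beta>" using pos by (simp add: \<beta>_def)
  \<comment> \<open>The upper growth constant \<open>c2\<close> controls the bias and the lower one
    \<open>c1\<close> the variance.\<close>
  obtain c2 where c2: "c2 > 0" "\<forall>\<^sub>F N in ?F. real (k N * M N) \<le> c2 * real N powr \<gamma>"
    using landau_o.bigE[OF bigthetaD1[OF \<Theta>]] unfolding \<gamma>_def by auto
  obtain c1 where c1: "c1 > 0" "\<forall>\<^sub>F N in ?F. c1 * real N powr \<gamma> \<le> real (k N * M N)"
    using landau_omega.bigE[OF bigthetaD2[OF \<Theta>]] unfolding \<gamma>_def by auto
  have NS: "\<forall>\<^sub>F N in ?F. N \<in> S \<and> 0 < N"
    unfolding eventually_inf_principal using eventually_gt_at_top[of 0] by eventually_elim simp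
  define K where "K = 4 * V / c1 + 4 * A\<^sup>2 * ((c2 / C_d) powr \<beta> * tail_series \<beta>)"
  show "(\<lambda>N. selective_knn_risk P \<eta> N (k N) (M N) (L N) (nb N) (sel N))
      \<in> O[?F](\<lambda>N. real N powr (- \<alpha> / (2 * \<alpha> + d)))"
  proof (rule bigoI[of _ "(K + 1) / 2"])
    show "\<forall>\<^sub>F N in ?F. norm (selective_knn_risk P \<eta> N (k N) (M N) (L N) (nb N) (sel N))
        \<le> (K + 1) / 2 * norm (real N powr (- \<alpha> / (2 * \<alpha> + d)))"
      using c1(2) c2(2) NS
    proof eventually_elim
      case (elim N)
      then have N: "N \<in> S" "0 < N" by auto
      have adm: "admissible_split N (k N) (M N)" and L_eq: "L N = nat \<lceil>real (M N) / 2\<rceil>"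
        and rule: "selection_rule N (k N) (M N) (L N) (nb N) (sel N)"
        using H N(1) by auto
      have kM: "1 \<le> k N" "1 \<le> M N" "M N dvd N" "k N + 1 \<le> N div M N"
        using adm by (auto simp: admissible_split_def)
      have L_half: "real (M N) / 2 \<le> real (L N)"
        unfolding L_eq by (rule of_nat_ceiling)
      with kM have L: "1 \<le> L N" by (cases "L N") auto
      \<comment> \<open>The free parameter is set to the target rate. A mean square bound
        \<open>K * (b * b)\<close> then yields the risk bound
        \<open>(K + 1) / 2 * b\<close>.\<close>
      define b where "b = real N powr (- \<gamma> / 2)"
      have b: "0 < b" using N by (simp add: b_def)
      have b2: "b * b = real N powr (- \<gamma>)"
        by (simp add: b_def powr_add[symmetric])
      have "2 * V / real (k N * L N) \<le> 4 * V / c1 * (b * b)"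
      proof -
        have "c1 * real N powr \<gamma> \<le> real (k N) * real (M N)" using elim(1) by simp
        also have "\<dots> \<le> 2 * real (k N * L N)"
          using L_half mult_left_mono[of "real (M N)" "2 * real (L N)" "real (k N)"] by simp
        finally have "2 * V / real (k N * L N) \<le> 2 * V / (c1 * real N powr \<gamma> / 2)"
          using V_nonneg c1(1) N kM L by (intro divide_left_mono) auto
        also have "\<dots> = 4 * V / c1 * (b * b)"
          unfolding b2 by (simp add: powr_minus field_simps)
        finally show ?thesis .
      qed
      moreover have "2 * A\<^sup>2 * (real (M N) / real (L N)) *
          ((real (k N) / (real (N div M N) * C_d)) powr \<beta> * tail_series \<beta>)
          \<le> 4 * A\<^sup>2 * ((c2 / C_d) powr \<beta> * tail_series \<beta>) * (b * b)"
      proof -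
        \<comment> \<open>Divisibility makes the block size exactly \<open>N / M\<close>, so only
          the product \<open>k * M\<close> enters.\<close>
        have "real (k N) / (real (N div M N) * C_d) = real (k N * M N) / (real N * C_d)"
          using kM N pos by (simp add: real_of_nat_div field_simps)
        also have "\<dots> \<le> c2 * real N powr \<gamma> / (real N * C_d)"
          using elim(2) N pos by (intro divide_right_mono) auto
        also have "\<dots> = c2 / C_d * real N powr (\<gamma> - 1)"
          using N by (simp add: powr_diff)
        finally have "(real (k N) / (real (N div M N) * C_d)) powr \<beta> \<le> (c2 / C_d * real N powr (\<gamma> - 1)) powr \<beta>"
          using \<beta> pos by (intro powr_mono2) auto
        also have "\<dots> = (c2 / C_d) powr \<beta> * (b * b)"
          unfolding b2 using c2(1) pos by (subst powr_mult) (auto simp: powr_powr \<gamma>\<beta>)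
        finally have "(real (k N) / (real (N div M N) * C_d)) powr \<beta> \<le> (c2 / C_d) powr \<beta> * (b * b)" .
        moreover have "real (M N) / real (L N) \<le> 2"
          using L_half L by (simp add: field_simps)
        ultimately have "2 * A\<^sup>2 * (real (M N) / real (L N)) *
          ((real (k N) / (real (N div M N) * C_d)) powr \<beta> * tail_series \<beta>)
          \<le> 2 * A\<^sup>2 * 2 * (((c2 / C_d) powr \<beta> * (b * b)) * tail_series \<beta>)"
          using tail_series_nonneg[of \<beta>] by (intro mult_mono mult_left_mono mult_right_mono) auto
        then show ?thesis by (simp add: mult_ac)
      qed
      ultimately have Q_le: "2 * V / real (k N * L N) + 2 * A\<^sup>2 * (real (M N) / real (L N)) *
          ((real (k N) / (real (N div M N) * C_d)) powr \<beta> * tail_series \<beta>) \<le> K * (b * b)"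
        unfolding K_def distrib_right by (rule add_mono)
      have "selective_knn_risk P \<eta> N (k N) (M N) (L N) (nb N) (sel N) \<le> K * (b * b) / (2 * b) + b / 2"
        using selective_knn_risk_le[OF rule adm L assms(8) pos assms(12) b] divide_right_mono[OF Q_le, of "2 * b"] b
        unfolding \<beta>_def by linarith
      also have "\<dots> = (K + 1) / 2 * b"
        using b by (simp add: field_simps)
      finally show ?case
        unfolding half by (simp add: b_def abs_of_nonneg selective_knn_risk_nonneg)
    qed
  qed
qed simp

end
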